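(* Let $\varepsilon\in\mathbb{R}$, let $M^2$ be a Riemann surface, and let $f:M^2\to H^3$ be the co-orientable linear Weingarten front of Bryant type in $W_\varepsilon(M^2)$, with unit normal field $\nu:M^2\to S^3_1$, given by $f=\mathcal{G}\mathcal{A}\mathcal{G}^*$ and $\nu=\mathcal{G}\mathcal{B}\mathcal{G}^*$ in terms of the data $(G,h)$ described in the context. Then the opposite hyperbolic Gauss map $G_*:=[f-\nu]$ is given by $$G_*=G-\frac{(G_h)^2(1+\varepsilon|h|^2)}{\varepsilon\,\bar h\,G_h+\frac{G_{hh}}{2}(1+\varepsilon|h|^2)},$$ where $G_h:=dG/dh$ and $G_{hh}:=dG_h/dh$.
   Context: Models. $\mathbb{R}^4_1$ (metric $-x_0y_0+x_1y_1+x_2y_2+x_3y_3$) is identified with the $2\times2$ Hermitian matrices by $$(x_0,x_1,x_2,x_3)\leftrightarrow\begin{pmatrix}x_0+x_3&x_1+ix_2\\ x_1-ix_2&x_0-x_3\end{pmatrix},$$ so $\langle X,X\rangle=-\det X$, $H^3=\{X=X^*:\det X=1,\ \operatorname{trace}X>0\}$ and $S^3_1=\{X=X^*:\det X=-1\}$, where $X^*={}^t\bar X$. The set of positively oriented lightlike lines (classes $[p]$ of nonzero vectors $p$ in the positive light cone up to positive scalars) is identified with $\mathbb{C}\cup\{\infty\}$: the class of $\binom{u}{v}(\bar u\ \bar v)$ corresponds to $u/v$. For a co-orientable front $f$ with unit normal $\nu$, the hyperbolic Gauss map is $G=[f+\nu]$ and the opposite hyperbolic Gauss map is $G_*=[f-\nu]$.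 $W_\varepsilon(M^2)$ is the set of fronts $f:M^2\to H^3$ which are horospherical linear Weingarten (locally some parallel surface $(\cosh\delta)f+(\sinh\delta)\nu$ is an immersion satisfying $a(H-1)+bK=0$ for constants $(a,b)\neq(0,0)$) and satisfy $2\varepsilon(H-1)+(1-\varepsilon)K=0$ on the regular set, with $H$ the mean curvature with respect to $\nu$ and $K$ the Gaussian curvature. Data. $G$ is a meromorphic function on $M^2$ and $h$ is a meromorphic function on the universal covering $\tilde M^2$ such that $d\sigma^2:=4|dh|^2/(1+\varepsilon|h|^2)^2$ gives a single-valued symmetric tensor (pseudometric) on $M^2$, and such that $$\frac{1+\varepsilon^2}{2}d\sigma^2+\frac{8|Q|^2}{d\sigma^2}-2\varepsilon(Q+\bar Q)$$ is positive definite, where $Q:=\frac12\left(\{h:z\}-\{G:z\}\right)dz^2$ with $\{\cdot:z\}$ the Schwarzian derivative. When $\varepsilon<0$ it is understood that $1+\varepsilon|h|^2>0$. Set $$\mathcal{G}:=i(G_h)^{-3/2}\begin{pmatrix}-GG_h&\frac{GG_{hh}}{2}-(G_h)^2\\-G_h&\frac{G_{hh}}{2}\end{pmatrix},$$ $$\mathcal{A}:=\begin{pmatrix}\frac{1+\varepsilon^2|h|^2}{1+\varepsilon|h|^2}&-\varepsilon\bar h\\-\varepsilon h&1+\varepsilon|h|^2\end{pmatrix},\qquad \mathcal{B}:=\begin{pmatrix}\frac{1-\varepsilon^2|h|^2}{1+\varepsilon|h|^2}&\varepsilon\bar h\\ \varepsilon h&-1-\varepsilon|h|^2\end{pmatrix}.$$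 It is known that $f=\mathcal{G}\mathcal{A}\mathcal{G}^*$ is then a well-defined co-orientable front in $W_\varepsilon(M^2)$ with unit normal $\nu=\mathcal{G}\mathcal{B}\mathcal{G}^*$ and hyperbolic Gauss map $G$. Formulas are read as identities of maps into $\mathbb{C}\cup\{\infty\}$ at points where $h,G,G_h,G_{hh}$ are finite and $G_h\ne0$, and by continuity elsewhere. *)

theory Defs
  imports "HOL-Complex_Analysis.Complex_Analysis"
begin

section \<open>The Riemann sphere\<close>

text \<open>\<open>\<complex> \<union> {\<infinity>}\<close> is \<^typ>\<open>complex option\<close> with \<open>\<infinity> = None\<close>.\<close>

definition riemann_sphere :: "complex option topology" where
  "riemann_sphere = Alexandroff_compactification euclidean"

text \<open>Only used for \<open>(a, b) \<noteq> (0, 0)\<close>.\<close>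

definition sphere_quot :: "complex \<Rightarrow> complex \<Rightarrow> complex option" where
  "sphere_quot a b = (if b = 0 then None else Some (a / b))"


section \<open>Riemann surfaces and meromorphic functions\<close>

text \<open>A chart is a pair \<open>(U, z)\<close>; only the values of \<open>z\<close> on \<open>U\<close> matter. Second countability is
  automatic (Rado's theorem) and the Hausdorff property is imposed by the type class.\<close>

definition complex_atlas :: "'m::t2_space set \<Rightarrow> ('m set \<times> ('m \<Rightarrow> complex)) set \<Rightarrow> bool" where
  "complex_atlas M A \<longleftrightarrow>
     \<Union> (fst ` A) = M \<and>
     (\<forall>(U, z) \<in> A. openin (top_of_set M) U \<and> open (z ` U) \<and>
        homeomorphism U (z ` U) z (inv_into U z)) \<and>
     (\<forall>(U, z) \<in> A. \<forall>(V, w) \<in> A. (w \<circ> inv_into U z) holomorphic_on z ` (U \<inter> V))"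

definition riemann_surface :: "'m::t2_space set \<Rightarrow> ('m set \<times> ('m \<Rightarrow> complex)) set \<Rightarrow> bool" where
  "riemann_surface M A \<longleftrightarrow> M \<noteq> {} \<and> connected M \<and> complex_atlas M A"

definition universal_covering ::
    "'t::t2_space set \<Rightarrow> ('t \<Rightarrow> 'm::t2_space) \<Rightarrow> 'm set \<Rightarrow> bool" where
  "universal_covering Mt pr M \<longleftrightarrow> covering_space Mt pr M \<and> simply_connected Mt"

text \<open>The complex structure which a covering space inherits from the base.\<close>

definition lifted_atlas ::
    "'t::t2_space set \<Rightarrow> ('t \<Rightarrow> 'm::t2_space) \<Rightarrow> ('m set \<times> ('m \<Rightarrow> complex)) set
      \<Rightarrow> ('t set \<times> ('t \<Rightarrow> complex)) set" where
  "lifted_atlas Mt pr A =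
     {(U, w \<circ> pr) | U V w.
        (V, w) \<in> A \<and> openin (top_of_set Mt) U \<and> inj_on pr U \<and> pr ` U \<subseteq> V}"

text \<open>Coordinate expression of a sphere-valued function. The value at poles is \<open>0\<close>, as the library's
  \<^const>\<open>nicely_meromorphic_on\<close> requires.\<close>

definition local_expr ::
    "('m \<Rightarrow> complex option) \<Rightarrow> 'm set \<Rightarrow> ('m \<Rightarrow> complex) \<Rightarrow> complex \<Rightarrow> complex" where
  "local_expr F U z x = (case F (inv_into U z x) of None \<Rightarrow> 0 | Some c \<Rightarrow> c)"

definition meromorphic_fun ::
    "('m set \<times> ('m \<Rightarrow> complex)) set \<Rightarrow> ('m \<Rightarrow> complex option) \<Rightarrow> bool" where
  "meromorphic_fun A F \<longleftrightarrow>
     (\<forall>(U, z) \<in> A. local_expr F U z nicely_meromorphic_on z ` U \<and>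
        (\<forall>p \<in> U. F p = None \<longleftrightarrow> is_pole (local_expr F U z) (z p)))"

text \<open>\<open>dF/dh = (dF/dz) / (dh/dz)\<close> as a sphere-valued function, with removable singularities removed.
  For meromorphic \<open>F\<close> and nonconstant meromorphic \<open>h\<close> the value does not depend on the chart chosen.\<close>

definition mero_deriv ::
    "('m set \<times> ('m \<Rightarrow> complex)) set \<Rightarrow> ('m \<Rightarrow> complex option) \<Rightarrow> ('m \<Rightarrow> complex option)
      \<Rightarrow> 'm \<Rightarrow> complex option" where
  "mero_deriv A F h p =
     (let (U, z) = (SOME c. c \<in> A \<and> p \<in> fst c);
          D = (\<lambda>x. deriv (local_expr F U z) x / deriv (local_expr h U z) x)
      in if is_pole D (z p) then None else Some (remove_sings D (z p)))"

definition schwarzian :: "(complex \<Rightarrow> complex) \<Rightarrow> complex \<Rightarrow> complex" where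
  "schwarzian F x =
     deriv (\<lambda>y. deriv (deriv F) y / deriv F y) x - (deriv (deriv F) x / deriv F x)\<^sup>2 / 2"


section \<open>Hyperbolic space in the Hermitian model\<close>

definition cmat :: "complex \<Rightarrow> complex \<Rightarrow> complex \<Rightarrow> complex \<Rightarrow> complex^2^2" where
  "cmat a b c d = vector [vector [a, b], vector [c, d]]"

definition adj :: "complex^2^2 \<Rightarrow> complex^2^2" where
  "adj X = map_matrix cnj (transpose X)"

text \<open>The polarization of \<open>\<langle>X,X\<rangle> = - det X\<close>.\<close>

definition lorentz :: "complex^2^2 \<Rightarrow> complex^2^2 \<Rightarrow> real" where
  "lorentz X Y = Re (det X + det Y - det (X + Y)) / 2"

definition herm :: "real \<Rightarrow> real \<Rightarrow> real \<Rightarrow> real \<Rightarrow> complex^2^2" where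
  "herm x0 x1 x2 x3 = cmat (of_real (x0 + x3)) (of_real x1 + \<i> * of_real x2)
                           (of_real x1 - \<i> * of_real x2) (of_real (x0 - x3))"

lemma lorentz_herm:
  "lorentz (herm x0 x1 x2 x3) (herm y0 y1 y2 y3) = - x0 * y0 + x1 * y1 + x2 * y2 + x3 * y3"
  by (simp add: lorentz_def herm_def cmat_def det_2 field_simps)

definition hyperbolic3 :: "(complex^2^2) set" where
  "hyperbolic3 = {X. adj X = X \<and> det X = 1 \<and> Re (trace X) > 0}"

definition de_sitter3 :: "(complex^2^2) set" where
  "de_sitter3 = {X. adj X = X \<and> det X = -1}"

text \<open>The class \<open>[p]\<close> of a vector of the positive light cone, and the point of the sphere which
  corresponds to a class.\<close>

definition light_ray :: "complex^2^2 \<Rightarrow> (complex^2^2) set" where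
  "light_ray p = {r *\<^sub>R p | r. r > 0}"

definition sphere_point :: "(complex^2^2) set \<Rightarrow> complex option" where
  "sphere_point L =
     (THE c. \<exists>u v. (u, v) \<noteq> (0, 0) \<and>
        cmat (u * cnj u) (u * cnj v) (v * cnj u) (v * cnj v) \<in> L \<and> c = sphere_quot u v)"

definition opposite_gauss_map ::
    "('m \<Rightarrow> complex^2^2) \<Rightarrow> ('m \<Rightarrow> complex^2^2) \<Rightarrow> 'm \<Rightarrow> complex option" where
  "opposite_gauss_map f nu p = sphere_point (light_ray (f p - nu p))"


section \<open>Local differential geometry of surfaces in \<open>\<real>\<^sup>4\<^sub>1\<close>\<close>

text \<open>Local parametrizations are defined on open subsets of \<open>\<complex> = \<real>\<^sup>2\<close>; all derivatives in this section
  are real.\<close>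

primrec C_k_on :: "nat \<Rightarrow> (complex \<Rightarrow> 'b::real_normed_vector) \<Rightarrow> complex set \<Rightarrow> bool" where
  "C_k_on 0 F S = continuous_on S F"
| "C_k_on (Suc k) F S =
     ((\<forall>x\<in>S. F differentiable (at x)) \<and> (\<forall>v. C_k_on k (\<lambda>x. frechet_derivative F (at x) v) S))"

definition smooth_on :: "(complex \<Rightarrow> 'b::real_normed_vector) \<Rightarrow> complex set \<Rightarrow> bool" where
  "smooth_on F S \<longleftrightarrow> (\<forall>k. C_k_on k F S)"

text \<open>The index type \<open>2\<close> has the elements \<open>1\<close> and \<open>2 = 0\<close>.\<close>

definition partial :: "2 \<Rightarrow> (complex \<Rightarrow> 'b::real_normed_vector) \<Rightarrow> complex \<Rightarrow> 'b" where
  "partial i F x = frechet_derivative F (at x) (if i = 1 then 1 else \<i>)"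

definition immersed_at :: "(complex \<Rightarrow> 'b::real_normed_vector) \<Rightarrow> complex \<Rightarrow> bool" where
  "immersed_at F x \<longleftrightarrow> inj (frechet_derivative F (at x))"

definition first_form :: "(complex \<Rightarrow> complex^2^2) \<Rightarrow> complex \<Rightarrow> real^2^2" where
  "first_form F x = (\<chi> i j. lorentz (partial i F x) (partial j F x))"

definition second_form ::
    "(complex \<Rightarrow> complex^2^2) \<Rightarrow> (complex \<Rightarrow> complex^2^2) \<Rightarrow> complex \<Rightarrow> real^2^2" where
  "second_form F N x = (\<chi> i j. - lorentz (partial i F x) (partial j N x))"

definition mean_curvature ::
    "(complex \<Rightarrow> complex^2^2) \<Rightarrow> (complex \<Rightarrow> complex^2^2) \<Rightarrow> complex \<Rightarrow> real" where
  "mean_curvature F N x = trace (matrix_inv (first_form F x) ** second_form F N x) / 2"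

definition christoffel :: "(complex \<Rightarrow> real^2^2) \<Rightarrow> 2 \<Rightarrow> 2 \<Rightarrow> 2 \<Rightarrow> complex \<Rightarrow> real" where
  "christoffel g k i j x =
     (\<Sum>l\<in>UNIV. matrix_inv (g x) $ k $ l *
        (partial i (\<lambda>y. g y $ j $ l) x + partial j (\<lambda>y. g y $ i $ l) x
          - partial l (\<lambda>y. g y $ i $ j) x)) / 2"

text \<open>\<open>R(e\<^sub>i, e\<^sub>j) e\<^sub>k = (\<Sum>l. riemann_tensor g l k i j e\<^sub>l)\<close>,
  where \<open>R(X, Y) = [\<nabla>\<^sub>X, \<nabla>\<^sub>Y] - \<nabla>\<^bsub>[X, Y]\<^esub>\<close>.\<close>

definition riemann_tensor ::
    "(complex \<Rightarrow> real^2^2) \<Rightarrow> 2 \<Rightarrow> 2 \<Rightarrow> 2 \<Rightarrow> 2 \<Rightarrow> complex \<Rightarrow> real" where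
  "riemann_tensor g l k i j x =
     partial i (christoffel g l j k) x - partial j (christoffel g l i k) x +
     (\<Sum>m\<in>UNIV. christoffel g l i m x * christoffel g m j k x
               - christoffel g l j m x * christoffel g m i k x)"

text \<open>The (intrinsic) Gaussian curvature \<open>\<langle>R(e\<^sub>1, e\<^sub>2) e\<^sub>2, e\<^sub>1\<rangle> / det g\<close> of the first fundamental form.
  In \<open>H\<^sup>3\<close> it is \<open>-1 + \<kappa>\<^sub>1 \<kappa>\<^sub>2\<close>.\<close>

definition gaussian_curvature :: "(complex \<Rightarrow> complex^2^2) \<Rightarrow> complex \<Rightarrow> real" where
  "gaussian_curvature F x =
     (\<Sum>l\<in>UNIV. first_form F x $ 1 $ l * riemann_tensor (first_form F) l 2 1 2 x)
       / det (first_form F x)"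


section \<open>Fronts and linear Weingarten fronts of Bryant type\<close>

text \<open>A co-orientable front with its unit normal: \<open>(f, \<nu>)\<close> is a Legendrian immersion into
  \<open>T\<^sub>1H\<^sup>3 = {(x, n). x \<in> H\<^sup>3, n \<in> S\<^sup>3\<^sub>1, \<langle>x, n\<rangle> = 0}\<close>.\<close>

definition front ::
    "'m::t2_space set \<Rightarrow> ('m set \<times> ('m \<Rightarrow> complex)) set
      \<Rightarrow> ('m \<Rightarrow> complex^2^2) \<Rightarrow> ('m \<Rightarrow> complex^2^2) \<Rightarrow> bool" where
  "front M A f nu \<longleftrightarrow>
     (\<forall>p\<in>M. f p \<in> hyperbolic3 \<and> nu p \<in> de_sitter3 \<and> lorentz (f p) (nu p) = 0) \<and>
     (\<forall>(U, z) \<in> A. let F = f \<circ> inv_into U z; N = nu \<circ> inv_into U z in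
        smooth_on F (z ` U) \<and> smooth_on N (z ` U) \<and>
        (\<forall>x \<in> z ` U. (\<forall>v. lorentz (frechet_derivative F (at x) v) (N x) = 0) \<and>
                      immersed_at (\<lambda>y. (F y, N y)) x))"

text \<open>The curvatures of the parallel surface are taken with respect to its unit normal
  \<open>(sinh \<delta>) f + (cosh \<delta>) \<nu>\<close>.\<close>

definition horospherical_linear_weingarten ::
    "'m::t2_space set \<Rightarrow> ('m set \<times> ('m \<Rightarrow> complex)) set
      \<Rightarrow> ('m \<Rightarrow> complex^2^2) \<Rightarrow> ('m \<Rightarrow> complex^2^2) \<Rightarrow> bool" where
  "horospherical_linear_weingarten M A f nu \<longleftrightarrow>
     (\<forall>p\<in>M. \<exists>V d a b. openin (top_of_set M) V \<and> p \<in> V \<and> (a, b) \<noteq> (0, 0) \<and>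
        (\<forall>(U, z) \<in> A.
           let F = (\<lambda>x. cosh d *\<^sub>R f (inv_into U z x) + sinh d *\<^sub>R nu (inv_into U z x));
               N = (\<lambda>x. sinh d *\<^sub>R f (inv_into U z x) + cosh d *\<^sub>R nu (inv_into U z x))
           in \<forall>x \<in> z ` (U \<inter> V). immersed_at F x \<and>
                a * (mean_curvature F N x - 1) + b * gaussian_curvature F x = 0))"

definition W_fronts ::
    "real \<Rightarrow> 'm::t2_space set \<Rightarrow> ('m set \<times> ('m \<Rightarrow> complex)) set
      \<Rightarrow> (('m \<Rightarrow> complex^2^2) \<times> ('m \<Rightarrow> complex^2^2)) set" where
  "W_fronts e M A = {(f, nu).
     front M A f nu \<and> horospherical_linear_weingarten M A f nu \<and>
     (\<forall>(U, z) \<in> A. let F = f \<circ> inv_into U z; N = nu \<circ> inv_into U z in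
        \<forall>x \<in> z ` U. immersed_at F x \<longrightarrow>
          2 * e * (mean_curvature F N x - 1) + (1 - e) * gaussian_curvature F x = 0)}"


section \<open>The representation data\<close>

text \<open>The coefficient of \<open>|dz|\<^sup>2\<close> in \<open>d\<sigma>\<^sup>2\<close>, for the coordinate expression \<open>H\<close> of \<open>h\<close>.\<close>

definition sigma_coeff :: "real \<Rightarrow> (complex \<Rightarrow> complex) \<Rightarrow> complex \<Rightarrow> real" where
  "sigma_coeff e H x = 4 * (cmod (deriv H x))\<^sup>2 / (1 + e * (cmod (H x))\<^sup>2)\<^sup>2"

definition Q_coeff :: "(complex \<Rightarrow> complex) \<Rightarrow> (complex \<Rightarrow> complex) \<Rightarrow> complex \<Rightarrow> complex" where
  "Q_coeff Gz H x = (schwarzian H x - schwarzian Gz x) / 2"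

text \<open>The quadratic form \<open>(1+\<epsilon>\<^sup>2)/2 d\<sigma>\<^sup>2 + 8|Q|\<^sup>2/d\<sigma>\<^sup>2 - 2\<epsilon>(Q + cnj Q)\<close> on the tangent vector \<open>v \<in> \<complex>\<close>.\<close>

definition data_metric ::
    "real \<Rightarrow> (complex \<Rightarrow> complex) \<Rightarrow> (complex \<Rightarrow> complex) \<Rightarrow> complex \<Rightarrow> complex \<Rightarrow> real" where
  "data_metric e Gz H x v =
     (1 + e\<^sup>2) / 2 * (sigma_coeff e H x * (cmod v)\<^sup>2)
     + 8 * (cmod (Q_coeff Gz H x * v\<^sup>2))\<^sup>2 / (sigma_coeff e H x * (cmod v)\<^sup>2)
     - 2 * e * Re (Q_coeff Gz H x * v\<^sup>2 + cnj (Q_coeff Gz H x * v\<^sup>2))"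

text \<open>The tensors extend continuously over the isolated points at which their coefficient formulas
  break down (poles of \<open>h\<close> and \<open>G\<close>, zeros of \<open>dh\<close> and \<open>dG\<close>). Accordingly, single-valuedness means
  that away from the poles of \<open>h\<close> the form is the pull-back of a smooth tensor \<open>\<mu> |dw|\<^sup>2\<close> on \<open>M\<close>, and
  positivity at a point is that of the limit.\<close>

definition representation_data ::
    "real \<Rightarrow> 'm::t2_space set \<Rightarrow> ('m set \<times> ('m \<Rightarrow> complex)) set \<Rightarrow> 't::t2_space set \<Rightarrow> ('t \<Rightarrow> 'm)
      \<Rightarrow> ('m \<Rightarrow> complex option) \<Rightarrow> ('t \<Rightarrow> complex option) \<Rightarrow> bool" where
  "representation_data e M A Mt pr G h \<longleftrightarrow>
     meromorphic_fun A G \<and> \<not> G constant_on M \<and>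
     meromorphic_fun (lifted_atlas Mt pr A) h \<and> \<not> h constant_on Mt \<and>
     (e < 0 \<longrightarrow> (\<forall>q\<in>Mt. \<exists>c. h q = Some c \<and> 1 + e * (cmod c)\<^sup>2 > 0)) \<and>
     (\<forall>(V, w) \<in> A. \<exists>\<mu>. smooth_on \<mu> (w ` V) \<and>
        (\<forall>U. openin (top_of_set Mt) U \<and> inj_on pr U \<and> pr ` U \<subseteq> V \<longrightarrow>
           (\<forall>q\<in>U. h q \<noteq> None \<longrightarrow>
              \<mu> (w (pr q)) = sigma_coeff e (local_expr h U (w \<circ> pr)) (w (pr q))))) \<and>
     (\<forall>(U, z) \<in> lifted_atlas Mt pr A. \<forall>q\<in>U. \<forall>v. v \<noteq> 0 \<longrightarrow>
        (\<exists>l>0. (\<lambda>x. data_metric e (local_expr (G \<circ> pr) U z) (local_expr h U z) x v) \<midarrow>z q\<rightarrow> l))"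

text \<open>In the following definitions \<open>g\<close>, \<open>g1\<close>, \<open>g2\<close>, \<open>h\<close> are the values of \<open>G\<close>, \<open>G\<^sub>h\<close>, \<open>G\<^sub>h\<^sub>h\<close>, \<open>h\<close> at a
  point. The branch of \<open>G\<^sub>h\<close> to the power \<open>-3/2\<close> is immaterial: it determines the matrix up to sign,
  which cancels in \<open>\<G> X \<G>\<^sup>*\<close>.\<close>

definition rep_G :: "complex \<Rightarrow> complex \<Rightarrow> complex \<Rightarrow> complex^2^2" where
  "rep_G g g1 g2 =
     (let s = \<i> * g1 powr (- 3 / 2)
      in cmat (s * (- g * g1)) (s * (g * g2 / 2 - g1\<^sup>2)) (s * (- g1)) (s * (g2 / 2)))"

definition rep_A :: "real \<Rightarrow> complex \<Rightarrow> complex^2^2" where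
  "rep_A e h =
     cmat (of_real ((1 + e\<^sup>2 * (cmod h)\<^sup>2) / (1 + e * (cmod h)\<^sup>2))) (- of_real e * cnj h)
          (- of_real e * h) (of_real (1 + e * (cmod h)\<^sup>2))"

definition rep_B :: "real \<Rightarrow> complex \<Rightarrow> complex^2^2" where
  "rep_B e h =
     cmat (of_real ((1 - e\<^sup>2 * (cmod h)\<^sup>2) / (1 + e * (cmod h)\<^sup>2))) (of_real e * cnj h)
          (of_real e * h) (of_real (- 1 - e * (cmod h)\<^sup>2))"

definition regular_points ::
    "'t set \<Rightarrow> ('t \<Rightarrow> complex option) \<Rightarrow> ('t \<Rightarrow> complex option) \<Rightarrow> ('t \<Rightarrow> complex option)
      \<Rightarrow> ('t \<Rightarrow> complex option) \<Rightarrow> 't set" where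
  "regular_points Mt G Gh Ghh h =
     {q \<in> Mt. h q \<noteq> None \<and> G q \<noteq> None \<and> Gh q \<noteq> None \<and> Ghh q \<noteq> None \<and> Gh q \<noteq> Some 0}"

text \<open>\<open>f\<close> and \<open>\<nu>\<close> live on \<open>M\<close>, the right-hand sides on the universal covering. The regular points are
  dense, so the formulas determine the continuous maps \<open>f\<close> and \<open>\<nu>\<close> everywhere.\<close>

definition given_by_data ::
    "real \<Rightarrow> ('m set \<times> ('m \<Rightarrow> complex)) set \<Rightarrow> 't::t2_space set \<Rightarrow> ('t \<Rightarrow> 'm::t2_space)
      \<Rightarrow> ('m \<Rightarrow> complex option) \<Rightarrow> ('t \<Rightarrow> complex option)
      \<Rightarrow> ('m \<Rightarrow> complex^2^2) \<Rightarrow> ('m \<Rightarrow> complex^2^2) \<Rightarrow> bool" where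
  "given_by_data e A Mt pr G h f nu \<longleftrightarrow>
     (let Gh = mero_deriv (lifted_atlas Mt pr A) (G \<circ> pr) h;
          Ghh = mero_deriv (lifted_atlas Mt pr A) Gh h
      in \<forall>q \<in> regular_points Mt (G \<circ> pr) Gh Ghh h.
           let P = rep_G (the (G (pr q))) (the (Gh q)) (the (Ghh q))
           in f (pr q) = P ** rep_A e (the (h q)) ** adj P \<and>
              nu (pr q) = P ** rep_B e (the (h q)) ** adj P)"

text \<open>\<open>g - g1\<^sup>2 (1 + \<epsilon>|h|\<^sup>2) / (\<epsilon> cnj h g1 + g2/2 (1 + \<epsilon>|h|\<^sup>2))\<close> on the sphere.\<close>

definition opposite_gauss_formula ::
    "real \<Rightarrow> complex \<Rightarrow> complex \<Rightarrow> complex \<Rightarrow> complex \<Rightarrow> complex option" where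
  "opposite_gauss_formula e g g1 g2 h =
     map_option (\<lambda>t. g - t)
       (sphere_quot (g1\<^sup>2 * of_real (1 + e * (cmod h)\<^sup>2))
          (of_real e * cnj h * g1 + g2 / 2 * of_real (1 + e * (cmod h)\<^sup>2)))"

end

theory Submission
  imports Defs
begin

text \<open>With \<open>s = 1 + \<epsilon>|h|\<^sup>2 > 0\<close> and \<open>w = (\<epsilon> cnj h, -s)\<close> one has \<open>\<A> - \<B> = (2/s) w w\<^sup>*\<close>, so
  \<open>f - \<nu> = (2/s) (\<G>w)(\<G>w)\<^sup>*\<close> and \<open>G\<^sub>*\<close> is the quotient of the two components of \<open>\<G>w\<close>. The
  remaining points are limits of regular ones, because the nonconstant meromorphic functions \<open>G\<close> and \<open>h\<close> are
  locally nonconstant, and there the formula persists because \<open>f - \<nu>\<close> depends continuously on the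
  point, never vanishes, and stays in the positive light cone.\<close>

subsection \<open>Meromorphic functions on Riemann surfaces\<close>

text \<open>Up to a nonzero scalar, the representation matrix sends \<open>w\<close> to
  \<open>(g * D - g1\<^sup>2 * s, D)\<close> with
  \<open>D = \<epsilon> * cnj h * g1 + g2 / 2 * s\<close>. The quotient of the components is
  therefore the claimed formula, with value infinity exactly when \<open>D = 0\<close>, and the
  vector is nonzero because \<open>g1\<close> and \<open>s\<close> are. The density of regular
  points meets another obstacle: \<open>mero_deriv\<close> differentiates in a chart picked by
  choice, possibly a different one at each point. \<open>G_hh\<close> can be handled only once
  \<open>G_h\<close> is known, in one fixed chart, to be a quotient of analytic functions on a whole
  neighbourhood.\<close>

lemma complex_atlasD:
  assumes "complex_atlas S B" "(U, z) \<in> B"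
  shows "openin (top_of_set S) U" "U \<subseteq> S" "open (z ` U)" "homeomorphism U (z ` U) z (inv_into U z)"
    "inj_on z U"
proof -
  show 1: "openin (top_of_set S) U" "open (z ` U)" "homeomorphism U (z ` U) z (inv_into U z)"
    using assms unfolding complex_atlas_def by blast+
  show "U \<subseteq> S"
    using 1 openin_imp_subset by blast
  show "inj_on z U"
    using 1(3) by (metis homeomorphism_def inj_on_inverseI)
qed

lemma complex_atlas_chart:
  assumes "complex_atlas S B" "p \<in> S"
  obtains U z where "(U, z) \<in> B" "p \<in> U"
proof -
  have "p \<in> \<Union> (fst ` B)"
    using assms unfolding complex_atlas_def by simp
  then show ?thesis
    using that by auto
qed

lemma homeomorphism_open_image:
  assumes "homeomorphism U (z ` U) z g" "open (z ` U)" "openin (top_of_set U) T"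
  shows "open (z ` T)"
  using homeomorphism_imp_open_map[OF assms(1,3)] assms(2) openin_open_eq by blast

text \<open>Continuity of the chart makes the preimage of the coordinate neighbourhood open, and
  injectivity keeps the points other than \<open>p\<close> away from \<open>z p\<close>.\<close>

lemma chart_eventually_at:
  assumes "complex_atlas S B" "(U, z) \<in> B" "p \<in> U" "eventually Q (at (z p))"
  obtains T where "openin (top_of_set S) T" "p \<in> T" "T \<subseteq> U" "\<And>x. x \<in> T \<Longrightarrow> x \<noteq> p \<Longrightarrow> Q (z x)"
proof -
  note ch = complex_atlasD[OF assms(1,2)]
  obtain W where W: "open W" "z p \<in> W" "\<And>y. y \<in> W \<Longrightarrow> y \<noteq> z p \<Longrightarrow> Q y"
    using assms(4) by (auto simp: eventually_at_topological)
  have "continuous_on U z"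
    using ch(4) by (simp add: homeomorphism_def)
  then have "openin (top_of_set U) (U \<inter> z -` W)"
    using W(1) continuous_openin_preimage_gen by blast
  then have "openin (top_of_set S) (U \<inter> z -` W)"
    using ch(1) openin_trans by blast
  then show ?thesis
    by (rule that) (use W assms(3) ch(5) in \<open>auto simp: inj_on_def\<close>)
qed

lemma local_expr_chart:
  assumes "inj_on z U" "p \<in> U"
  shows "local_expr F U z (z p) = (case F p of None \<Rightarrow> 0 | Some c \<Rightarrow> c)"
  using assms by (simp add: local_expr_def)

lemma meromorphic_fun_at:
  assumes "meromorphic_fun B F" "(U, z) \<in> B" "p \<in> U"
  shows "local_expr F U z meromorphic_on {z p}"
    "F p = None \<longleftrightarrow> is_pole (local_expr F U z) (z p)"
    "F p \<noteq> None \<Longrightarrow> local_expr F U z \<midarrow>z p\<rightarrow> local_expr F U z (z p)"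
proof -
  have L: "local_expr F U z nicely_meromorphic_on z ` U"
    "\<forall>p\<in>U. F p = None \<longleftrightarrow> is_pole (local_expr F U z) (z p)"
    using assms(1,2) unfolding meromorphic_fun_def by blast+
  have "z p \<in> z ` U"
    using assms(3) by simp
  with L(1) show "local_expr F U z meromorphic_on {z p}"
    unfolding nicely_meromorphic_on_def by (blast intro: meromorphic_on_subset)
  show "F p = None \<longleftrightarrow> is_pole (local_expr F U z) (z p)"
    using L(2) assms(3) by blast
  then show "local_expr F U z \<midarrow>z p\<rightarrow> local_expr F U z (z p)" if "F p \<noteq> None"
    using L(1) that \<open>z p \<in> z ` U\<close> unfolding nicely_meromorphic_on_def by blast
qed

lemma eventually_in_chart:
  assumes "complex_atlas S B" "(U, z) \<in> B" "p \<in> U"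
  shows "eventually (\<lambda>x. x \<in> z ` U) (at (z p))"
  using complex_atlasD(3)[OF assms(1,2)] assms(3) by (simp add: eventually_at_in_open')

text \<open>A Laurent expansion is either the zero series or has a leading term, which dominates
  near the point.\<close>

lemma meromorphic_zero_or_nonzero:
  assumes "f meromorphic_on {x}"
  shows "eventually (\<lambda>y. f y = 0) (at x) \<or> eventually (\<lambda>y. f y \<noteq> 0) (at x)"
proof -
  obtain L where L: "(\<lambda>w. f (x + w)) has_laurent_expansion L"
    using assms unfolding meromorphic_on_def by blast
  show ?thesis
    using has_laurent_expansion_eventually_zero_iff[OF L]
      has_laurent_expansion_eventually_nonzero_iff[OF L] by blast
qed

text \<open>Each alternative is recorded twice: on the surface, where it feeds a connectedness
  argument, and in the coordinate, where the punctured neighbourhood filter is nontrivial and the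
  two alternatives exclude each other.\<close>

lemma meromorphic_fun_eq_const_or_neq:
  assumes "complex_atlas S B" "meromorphic_fun B F" "(U, z) \<in> B" "p \<in> U"
  shows "(\<exists>T. openin (top_of_set S) T \<and> p \<in> T \<and> T \<subseteq> U \<and> (\<forall>x\<in>T. F x = Some c)) \<and>
      eventually (\<lambda>y. local_expr F U z y = c) (at (z p)) \<or>
    (\<exists>T. openin (top_of_set S) T \<and> p \<in> T \<and> T \<subseteq> U \<and> (\<forall>x\<in>T. x \<noteq> p \<longrightarrow> F x \<noteq> Some c)) \<and>
      eventually (\<lambda>y. local_expr F U z y \<noteq> c) (at (z p))"
proof -
  let ?L = "local_expr F U z"
  note ch = complex_atlasD[OF assms(1,3)]
  note mero = meromorphic_fun_at[OF assms(2,3)]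
  have "(\<lambda>y. ?L y - c) meromorphic_on {z p}"
    using mero(1)[OF assms(4)] by (intro meromorphic_intros)
  then consider "eventually (\<lambda>y. ?L y = c) (at (z p))" | "eventually (\<lambda>y. ?L y \<noteq> c) (at (z p))"
    using meromorphic_zero_or_nonzero by fastforce
  then show ?thesis
  proof cases
    case 1
    have "isolated_singularity_at ?L (z p)"
      using mero(1)[OF assms(4)] meromorphic_at_iff by blast
    \<comment> \<open>Poles are excluded separately: for \<open>c = 0\<close> the equation
      \<open>?L y = c\<close> also holds where \<open>F\<close> is \<open>None\<close>, because
      \<open>local_expr\<close> has value 0 there.\<close>
    then have "eventually (\<lambda>y. ?L y = c \<and> \<not> is_pole ?L y) (at (z p))"
      using 1 by (simp add: eventually_not_pole eventually_conj)
    then obtain T where T: "openin (top_of_set S) T" "p \<in> T" "T \<subseteq> U"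
      "\<And>x. x \<in> T \<Longrightarrow> x \<noteq> p \<Longrightarrow> ?L (z x) = c \<and> \<not> is_pole ?L (z x)"
      by (rule chart_eventually_at[OF assms(1,3,4)]) blast
    \<comment> \<open>The centre itself: a finite limit rules out a pole, and outside poles the
      value is the limit.\<close>
    have lim: "?L \<midarrow>z p\<rightarrow> c"
      using 1 by (rule tendsto_eventually)
    then have "\<not> is_pole ?L (z p)"
      unfolding is_pole_def by (meson at_neq_bot not_tendsto_and_filterlim_at_infinity)
    then have "?L \<midarrow>z p\<rightarrow> ?L (z p)"
      using mero(2,3)[OF assms(4)] by blast
    then have "?L (z p) = c"
      using lim by (rule LIM_unique)
    then have "F x = Some c" if "x \<in> T" for x
      using T(3) that T(4)[of x] \<open>\<not> is_pole ?L (z p)\<close> mero(2)[of x] local_expr_chart[OF ch(5), of x F]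
      by (cases "x = p") (auto split: option.splits)
    then show ?thesis
      using 1 T by blast
  next
    case 2
    then obtain T where T: "openin (top_of_set S) T" "p \<in> T" "T \<subseteq> U"
      "\<And>x. x \<in> T \<Longrightarrow> x \<noteq> p \<Longrightarrow> ?L (z x) \<noteq> c"
      by (rule chart_eventually_at[OF assms(1,3,4)]) blast
    then have "F x \<noteq> Some c" if "x \<in> T" "x \<noteq> p" for x
      using that local_expr_chart[OF ch(5), of x F] by fastforce
    then show ?thesis
      using 2 T by blast
  qed
qed

text \<open>Identity theorem. By the local dichotomy every point has a neighbourhood on which the
  property "\<open>F\<close> equals \<open>c\<close> near this point" holds everywhere or nowhere,
  so on a connected surface it holds everywhere as soon as it holds once.\<close>

lemma meromorphic_fun_not_locally_const:
  assumes "complex_atlas S B" "connected S" "meromorphic_fun B F" "\<not> F constant_on S"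
    "(U, z) \<in> B" "p \<in> U"
  shows "eventually (\<lambda>y. local_expr F U z y \<noteq> c) (at (z p))"
proof (rule ccontr)
  define P where "P x \<longleftrightarrow> (\<exists>T. openin (top_of_set S) T \<and> x \<in> T \<and> (\<forall>y\<in>T. F y = Some c))" for x
  assume "\<not> ?thesis"
  then have Pp: "P p"
    unfolding P_def using meromorphic_fun_eq_const_or_neq[OF assms(1,3,5,6), of c] by blast
  have pS: "p \<in> S"
    using complex_atlasD(2)[OF assms(1,5)] assms(6) by blast
  have "P b" if "b \<in> S" for b
  proof (rule connected_induction_simple[where P = P, OF assms(2) pS that Pp])
    fix a assume "a \<in> S"
    then obtain V w where V: "(V, w) \<in> B" "a \<in> V"
      using complex_atlas_chart[OF assms(1)] by blast
    consider T where "openin (top_of_set S) T" "a \<in> T" "\<forall>x\<in>T. F x = Some c"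
      | T where "openin (top_of_set S) T" "a \<in> T" "\<forall>x\<in>T. x \<noteq> a \<longrightarrow> F x \<noteq> Some c"
          "eventually (\<lambda>y. local_expr F V w y \<noteq> c) (at (w a))"
      using meromorphic_fun_eq_const_or_neq[OF assms(1,3) V, of c] by blast
    then show "\<exists>T. openin (top_of_set S) T \<and> a \<in> T \<and> (\<forall>x\<in>T. \<forall>y\<in>T. P x \<longrightarrow> P y)"
    proof cases
      case 1
      then show ?thesis
        unfolding P_def by blast
    next
      case 2
      \<comment> \<open>If \<open>F\<close> were \<open>c\<close> around \<open>a\<close>, its
        coordinate expression would be both equal to and different from \<open>c\<close> on a
        punctured neighbourhood of \<open>w a\<close>, which is nonempty.\<close>
      have "\<not> P a"
      proof
        assume "P a"
        then obtain T' where T': "openin (top_of_set S) T'" "a \<in> T'" "\<forall>y\<in>T'. F y = Some c"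
          unfolding P_def by blast
        note ch = complex_atlasD[OF assms(1) V(1)]
        have "openin (top_of_set V) (V \<inter> T')"
          using openin_Int[OF ch(1) T'(1)] ch(2) by (meson Int_lower1 openin_subset_trans)
        then have "open (w ` (V \<inter> T'))"
          by (rule homeomorphism_open_image[OF ch(4,3)])
        then have "eventually (\<lambda>y. y \<in> w ` (V \<inter> T')) (at (w a))"
          using V T' by (simp add: eventually_at_in_open')
        then have "eventually (\<lambda>y. local_expr F V w y = c) (at (w a))"
          by eventually_elim (use T' local_expr_chart[OF ch(5)] in auto)
        with 2(4) have "eventually (\<lambda>y. False) (at (w a))"
          by eventually_elim simp
        then show False
          by simp
      qed
      moreover have "\<not> P x" if "x \<in> T" "x \<noteq> a" for x
        using 2(3) that unfolding P_def by blast
      ultimately show ?thesis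
        using 2(1,2) by blast
    qed
  qed
  then have "F b = Some c" if "b \<in> S" for b
    using that unfolding P_def by blast
  then show False
    using assms(4) unfolding constant_on_def by blast
qed

text \<open>Nothing is known at \<open>x\<close> itself, so the argument takes place on a punctured
  disc, which is open and still connected.\<close>

lemma eventually_const_if_deriv_eq_0:
  assumes "f meromorphic_on {x}" "eventually (\<lambda>y. deriv f y = 0) (at x)"
  shows "\<exists>c. eventually (\<lambda>y. f y = c) (at (x::complex))"
proof -
  have "isolated_singularity_at f x"
    using assms(1) meromorphic_at_iff by blast
  then have "eventually (\<lambda>y. f analytic_on {y}) (at x)"
    by (simp add: isolated_singularity_at_altdef)
  with assms(2) have "eventually (\<lambda>y. f analytic_on {y} \<and> deriv f y = 0) (at x)"
    by eventually_elim simp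
  then obtain r where r: "r > 0" "\<And>y. y \<noteq> x \<Longrightarrow> dist y x < r \<Longrightarrow> f analytic_on {y} \<and> deriv f y = 0"
    unfolding eventually_at by auto
  let ?D = "ball x r - {x}"
  have D: "open ?D" "connected ?D"
    by (auto intro: connected_open_delete)
  have "(f has_field_derivative 0) (at y)" if "y \<in> ?D" for y
  proof -
    have "f analytic_on {y}" "deriv f y = 0"
      using r(2)[of y] that by (auto simp: dist_commute)
    then show ?thesis
      by (metis DERIV_deriv_iff_field_differentiable analytic_on_imp_differentiable_at singletonI)
  qed
  then have "f constant_on ?D"
    by (rule has_field_derivative_0_imp_constant_on) (use D in auto)
  then obtain c where "\<And>y. y \<in> ?D \<Longrightarrow> f y = c"
    unfolding constant_on_def by blast
  then show ?thesis
    using eventually_at_in_open[of "ball x r" x] r(1)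
    by (intro exI[of _ c]) (auto elim!: eventually_mono)
qed

text \<open>For \<open>h\<close> this keeps the denominator of \<open>dG/dh\<close> nonzero, for
  \<open>G\<close> its numerator, hence \<open>G_h\<close> itself.\<close>

lemma meromorphic_fun_deriv_nonzero:
  assumes "complex_atlas S B" "connected S" "meromorphic_fun B F" "\<not> F constant_on S"
    "(U, z) \<in> B" "p \<in> U"
  shows "eventually (\<lambda>y. deriv (local_expr F U z) y \<noteq> 0) (at (z p))"
proof (rule ccontr)
  let ?L = "local_expr F U z"
  have mero: "?L meromorphic_on {z p}"
    by (rule meromorphic_fun_at[OF assms(3,5,6)])
  assume "\<not> ?thesis"
  then have "eventually (\<lambda>y. deriv ?L y = 0) (at (z p))"
    using meromorphic_zero_or_nonzero[OF meromorphic_on_deriv[OF mero]] by blast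
  then obtain c where "eventually (\<lambda>y. ?L y = c) (at (z p))"
    using eventually_const_if_deriv_eq_0[OF mero] by blast
  moreover have "eventually (\<lambda>y. ?L y \<noteq> c) (at (z p))"
    by (rule meromorphic_fun_not_locally_const[OF assms])
  ultimately have "eventually (\<lambda>y. False) (at (z p))"
    by eventually_elim simp
  then show False
    by simp
qed

section \<open>Change of charts and the derivative with respect to a meromorphic function\<close>

lemma local_expr_transition:
  assumes "inj_on z U" "inj_on w V" "x \<in> z ` (U \<inter> V)"
  shows "local_expr F U z x = local_expr F V w ((w \<circ> inv_into U z) x)"
proof -
  obtain p where "p \<in> U" "p \<in> V" "x = z p"
    using assms(3) by blast
  then show ?thesis
    using assms(1,2) by (simp add: local_expr_def)
qed

lemma transition_map:
  assumes "complex_atlas S B" "(U, z) \<in> B" "(V, w) \<in> B"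
  defines "\<phi> \<equiv> w \<circ> inv_into U z"
  shows "open (z ` (U \<inter> V))" "\<phi> holomorphic_on z ` (U \<inter> V)"
    "x \<in> z ` (U \<inter> V) \<Longrightarrow> deriv \<phi> x \<noteq> 0"
proof -
  note U = complex_atlasD[OF assms(1,2)] and V = complex_atlasD[OF assms(1,3)]
  have "openin (top_of_set U) (U \<inter> V)"
    using openin_Int[OF U(1) V(1)] U(2) by (meson Int_lower1 openin_subset_trans)
  then show op: "open (z ` (U \<inter> V))"
    by (rule homeomorphism_open_image[OF U(4,3)])
  show hol: "\<phi> holomorphic_on z ` (U \<inter> V)"
    using assms(1-3) unfolding complex_atlas_def \<phi>_def by blast
  have "inj_on \<phi> (z ` (U \<inter> V))"
    using U(5) V(5) by (auto simp: inj_on_def \<phi>_def)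
  then show "x \<in> z ` (U \<inter> V) \<Longrightarrow> deriv \<phi> x \<noteq> 0"
    using holomorphic_injective_imp_regular[OF hol op] by blast
qed

text \<open>Frees \<open>mero_deriv\<close> from its choice of chart: by the chain rule both
  derivatives in the chosen chart carry the factor \<open>deriv \<phi>\<close> of the transition
  map, which is nonzero and cancels.\<close>

lemma mero_deriv_eq:
  assumes "complex_atlas S B" "(V, w) \<in> B" "p \<in> V"
    and F: "local_expr F V w analytic_on {w p}"
    and h: "local_expr h V w analytic_on {w p}" "deriv (local_expr h V w) (w p) \<noteq> 0"
  shows "mero_deriv B F h p =
    Some (deriv (local_expr F V w) (w p) / deriv (local_expr h V w) (w p))"
proof -
  have "\<exists>c. c \<in> B \<and> p \<in> fst c"
    using assms(2,3) by force
  then obtain U z where Uz: "(SOME c. c \<in> B \<and> p \<in> fst c) = (U, z)" "(U, z) \<in> B" "p \<in> U"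
    by (metis (mono_tags, lifting) fst_conv someI_ex surj_pair)
  define \<phi> where "\<phi> = w \<circ> inv_into U z"
  let ?W = "z ` (U \<inter> V)"
  note tr = transition_map[OF assms(1) Uz(2) assms(2), folded \<phi>_def]
  note U = complex_atlasD[OF assms(1) Uz(2)] and V = complex_atlasD[OF assms(1,2)]
  have zp: "z p \<in> ?W" and \<phi>p: "\<phi> (z p) = w p"
    using Uz(3) assms(3) U(5) by (auto simp: \<phi>_def)
  have \<phi>_an: "\<phi> analytic_on {z p}"
    using tr(1,2) zp analytic_at by blast
  have inW: "eventually (\<lambda>x. x \<in> ?W) (nhds (z p))"
    using tr(1) zp by (rule eventually_nhds_in_open)
  \<comment> \<open>A whole neighbourhood is needed, since analyticity of the quotient has to be
    transferred and not only its value.\<close>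
  have chain: "eventually (\<lambda>x. deriv (local_expr K U z) x
      = deriv (local_expr K V w) (\<phi> x) * deriv \<phi> x) (nhds (z p))"
    if K: "local_expr K V w analytic_on {w p}" for K
  proof -
    obtain T where T: "open T" "w p \<in> T" "local_expr K V w holomorphic_on T"
      using K analytic_at by blast
    have "isCont \<phi> (z p)"
      using \<phi>_an analytic_at_imp_isCont by blast
    then have "eventually (\<lambda>x. \<phi> x \<in> T) (nhds (z p))"
      using T(1,2) \<phi>p by (metis isCont_def tendsto_at_iff_tendsto_nhds topological_tendstoD)
    with inW show ?thesis
    proof eventually_elim
      case (elim x)
      have "eventually (\<lambda>y. local_expr K U z y = (local_expr K V w \<circ> \<phi>) y) (nhds x)"
        using eventually_nhds_in_open[OF tr(1) elim(1)]
        by eventually_elim (use local_expr_transition[OF U(5) V(5)] in \<open>simp add: \<phi>_def\<close>)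
      then have "deriv (local_expr K U z) x = deriv (local_expr K V w \<circ> \<phi>) x"
        by (rule deriv_cong_ev) simp
      also have "\<dots> = deriv (local_expr K V w) (\<phi> x) * deriv \<phi> x"
        using elim T tr(1,2) holomorphic_on_imp_differentiable_at by (intro deriv_chain) blast+
      finally show ?case .
    qed
  qed
  define D where "D = (\<lambda>x. deriv (local_expr F U z) x / deriv (local_expr h U z) x)"
  define E where "E = (\<lambda>y. deriv (local_expr F V w) y / deriv (local_expr h V w) y)"
  have "eventually (\<lambda>x. D x = (E \<circ> \<phi>) x) (nhds (z p))"
    using chain[OF F] chain[OF h(1)] inW
    by eventually_elim (use tr(3) in \<open>simp add: D_def E_def\<close>)
  moreover have "(E \<circ> \<phi>) analytic_on {z p}"
    using F h \<phi>p by (intro analytic_on_compose[OF \<phi>_an]) (auto simp: E_def intro!: analytic_intros)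
  ultimately have "D analytic_on {z p}" "D (z p) = E (w p)"
    using analytic_at_cong eventually_nhds_x_imp_x \<phi>p by (metis, fastforce)
  \<comment> \<open>At a point of analyticity there is no pole, and removing singularities leaves
    the value unchanged.\<close>
  then have "\<not> is_pole D (z p)" "remove_sings D (z p) = E (w p)"
    using analytic_at_imp_no_pole by auto
  then show ?thesis
    unfolding mero_deriv_def Uz(1) Let_def by (simp add: D_def E_def)
qed

text \<open>A punctured open set is open. This turns "good near \<open>p\<close>" into "good in a
  full neighbourhood of each point near \<open>p\<close>", as the second derivative
  requires.\<close>

lemma eventually_at_imp_eventually_nhds:
  fixes a :: "'a::t1_space"
  assumes "eventually P (at a)"
  shows "eventually (\<lambda>x. eventually P (nhds x)) (at a)"
proof -
  obtain T where T: "open T" "a \<in> T" "\<And>x. x \<in> T \<Longrightarrow> x \<noteq> a \<Longrightarrow> P x"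
    using assms by (auto simp: eventually_at_topological)
  have "eventually P (nhds x)" if "x \<in> T - {a}" for x
    using eventually_nhds_in_open[OF open_delete[OF T(1)] that] T(3) by (auto elim: eventually_mono)
  moreover have "eventually (\<lambda>x. x \<in> T - {a}) (at a)"
    using T(1,2) by (rule eventually_at_in_open)
  ultimately show ?thesis
    by (auto elim: eventually_mono)
qed

lemma eventually_regular:
  fixes F h :: "'m::t2_space \<Rightarrow> complex option"
  assumes "complex_atlas S B" "connected S"
    and F: "meromorphic_fun B F" "\<not> F constant_on S"
    and h: "meromorphic_fun B h" "\<not> h constant_on S"
    and "(U, z) \<in> B" "p \<in> U"
  defines "Fh \<equiv> mero_deriv B F h"
  shows "eventually (\<lambda>x. x \<in> z ` (U \<inter> regular_points S F Fh (mero_deriv B Fh h) h)) (at (z p))"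
proof -
  note U = complex_atlasD[OF assms(1,7)]
  define f where "f = local_expr F U z"
  define k where "k = local_expr h U z"
  define good where "good x \<longleftrightarrow> x \<in> z ` U \<and> f analytic_on {x} \<and> k analytic_on {x} \<and> deriv f x \<noteq> 0 \<and> deriv k x \<noteq> 0" for x
  have an: "eventually (\<lambda>x. local_expr K U z analytic_on {x}) (at (z p))" if "meromorphic_fun B K" for K
    using meromorphic_fun_at(1)[OF that assms(7,8)] meromorphic_at_iff isolated_singularity_at_altdef by blast
  have "eventually good (at (z p))"
    using eventually_in_chart[OF assms(1,7,8)] an[OF F(1)] an[OF h(1)]
      meromorphic_fun_deriv_nonzero[OF assms(1,2) F assms(7,8)]
      meromorphic_fun_deriv_nonzero[OF assms(1,2) h assms(7,8)]
    unfolding good_def f_def k_def by eventually_elim blast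
  then have "eventually (\<lambda>x. eventually good (nhds x)) (at (z p))"
    by (rule eventually_at_imp_eventually_nhds)
  then show ?thesis
  proof eventually_elim
    case (elim x)
    then have "good x"
      by (rule eventually_nhds_x_imp_x)
    then obtain q where q: "q \<in> U" "x = z q"
      unfolding good_def by blast
    have Fh: "Fh r = Some (deriv f (z r) / deriv k (z r))" if "r \<in> U" "good (z r)" for r
      using that mero_deriv_eq[OF assms(1,7) that(1), of F h] unfolding good_def Fh_def f_def k_def by blast
    \<comment> \<open>All points around \<open>x\<close> are good, so \<open>Fh\<close> is given
      there by one quotient in one chart; it is analytic and can be differentiated again.\<close>
    have "eventually (\<lambda>y. local_expr Fh U z y = deriv f y / deriv k y) (nhds x)"
      using elim
    proof eventually_elim
      case (elim y)
      then obtain r where "r \<in> U" "y = z r"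
        unfolding good_def by blast
      then show ?case
        using Fh elim local_expr_chart[OF U(5)] by simp
    qed
    moreover have "(\<lambda>y. deriv f y / deriv k y) analytic_on {x}"
      using \<open>good x\<close> unfolding good_def by (auto intro!: analytic_intros)
    ultimately have "local_expr Fh U z analytic_on {x}"
      by (simp add: analytic_at_cong)
    then have "mero_deriv B Fh h q \<noteq> None"
      using mero_deriv_eq[OF assms(1,7) q(1), of Fh h] \<open>good x\<close> q(2) unfolding good_def k_def by simp
    moreover have "Fh q \<noteq> None" "Fh q \<noteq> Some 0"
      using Fh[OF q(1)] \<open>good x\<close> q(2) unfolding good_def by auto
    moreover have "F q \<noteq> None" "h q \<noteq> None"
      using \<open>good x\<close> q meromorphic_fun_at(2)[OF F(1) assms(7) q(1)] meromorphic_fun_at(2)[OF h(1) assms(7) q(1)]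
      unfolding good_def f_def k_def by (auto dest: analytic_at_imp_no_pole)
    ultimately have "q \<in> regular_points S F Fh (mero_deriv B Fh h) h"
      using q(1) U(2) by (auto simp: regular_points_def)
    then show ?case
      using q by blast
  qed
qed

lemma islimpt_regular_points:
  fixes F h :: "'m::t2_space \<Rightarrow> complex option"
  assumes "complex_atlas S B" "connected S"
    and F: "meromorphic_fun B F" "\<not> F constant_on S"
    and h: "meromorphic_fun B h" "\<not> h constant_on S"
    and "p \<in> S"
  defines "Fh \<equiv> mero_deriv B F h"
  shows "p islimpt regular_points S F Fh (mero_deriv B Fh h) h"
proof -
  let ?R = "regular_points S F Fh (mero_deriv B Fh h) h"
  obtain U z where Uz: "(U, z) \<in> B" "p \<in> U"
    using complex_atlas_chart[OF assms(1,7)] by blast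
  note U = complex_atlasD[OF assms(1) Uz(1)]
  show ?thesis
  proof (rule islimptI)
    fix T assume T: "p \<in> T" "open T"
    have "openin (top_of_set U) (U \<inter> T)"
      using T(2) by (simp add: openin_open_Int)
    then have "open (z ` (U \<inter> T))"
      by (rule homeomorphism_open_image[OF U(4,3)])
    then have "eventually (\<lambda>x. x \<in> z ` (U \<inter> T) - {z p}) (at (z p))"
      using T(1) Uz(2) by (intro eventually_at_in_open) auto
    with eventually_regular[OF assms(1,2) F h Uz, folded Fh_def]
    have "eventually (\<lambda>x. \<exists>y\<in>?R. y \<in> T \<and> y \<noteq> p) (at (z p))"
      by eventually_elim (use U(5) in \<open>auto simp: inj_on_def\<close>)
    then show "\<exists>y\<in>?R. y \<in> T \<and> y \<noteq> p"
      by simp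
  qed
qed

subsection \<open>The complex structure of a covering\<close>

text \<open>Simple connectedness here means that any two loops are freely homotopic. For constant
  loops at \<open>a\<close> and \<open>b\<close> the homotopy traces a path from \<open>a\<close> to
  \<open>b\<close>.\<close>

lemma simply_connected_imp_path_connected_space:
  assumes "simply_connected S"
  shows "path_connected S"
  unfolding path_connected_component
proof (intro ballI)
  fix a b assume "a \<in> S" "b \<in> S"
  then have "homotopic_loops S (\<lambda>t. a) (\<lambda>t. b)"
    by (intro assms[unfolded simply_connected_def, rule_format])
      (auto simp: path_def path_image_def pathstart_def pathfinish_def)
  then show "path_component S a b"
    using homotopic_loops_imp_path_component_value[of S "\<lambda>t. a" "\<lambda>t. b" 0] by simp
qed

text \<open>Locally a covering map is a homeomorphism between open sets, and openness is a local
  matter.\<close>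

lemma covering_space_open_image:
  assumes "covering_space C p S" "openin (top_of_set C) T"
  shows "openin (top_of_set S) (p ` T)"
proof (subst openin_subopen, intro ballI)
  fix y assume "y \<in> p ` T"
  then obtain x where x: "x \<in> T" "y = p x"
    by blast
  then have "x \<in> C"
    using openin_imp_subset[OF assms(2)] by blast
  then obtain W u q where W: "x \<in> W" "openin (top_of_set C) W" "p x \<in> u" "openin (top_of_set S) u"
      "homeomorphism W u p q"
    by (rule covering_space_local_homeomorphism[OF assms(1)])
  have "openin (top_of_set W) (T \<inter> W)"
    using openin_Int[OF assms(2) W(2)] openin_imp_subset[OF W(2)] by (meson Int_lower2 openin_subset_trans)
  then have "openin (top_of_set u) (p ` (T \<inter> W))"
    by (rule homeomorphism_imp_open_map[OF W(5)])
  then have "openin (top_of_set S) (p ` (T \<inter> W))"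
    using W(4) by (rule openin_trans)
  then show "\<exists>T'. openin (top_of_set S) T' \<and> y \<in> T' \<and> T' \<subseteq> p ` T"
    using x W(1) by (intro exI[of _ "p ` (T \<inter> W)"]) auto
qed

text \<open>\<open>complex_atlas\<close> prescribes \<open>inv_into\<close> as the inverse of a
  chart; on the image it agrees with every other inverse.\<close>

lemma homeomorphism_inv_into:
  assumes "homeomorphism S T f g"
  shows "homeomorphism S T f (inv_into S f)"
proof (rule homeomorphism_cong[OF assms])
  have "inj_on f S"
    using assms by (metis homeomorphism_apply1 inj_on_inverseI)
  then show "inv_into S f y = g y" if "y \<in> T" for y
    using that assms by (metis homeomorphism_def imageI inv_into_f_f)
qed auto

text \<open>Openness follows because \<open>pr\<close> is open and \<open>w\<close> is a
  homeomorphism onto an open set. The last conclusion is what later identifies lifted coordinate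
  expressions and transition maps with restrictions of those on the base.\<close>

lemma lifted_chart:
  assumes "complex_atlas M A" "covering_space Mt pr M" "(V, w) \<in> A"
    and U: "openin (top_of_set Mt) U" "inj_on pr U" "pr ` U \<subseteq> V"
  shows "open ((w \<circ> pr) ` U)" "homeomorphism U ((w \<circ> pr) ` U) (w \<circ> pr) (inv_into U (w \<circ> pr))"
    "inj_on (w \<circ> pr) U"
    "x \<in> (w \<circ> pr) ` U \<Longrightarrow> pr (inv_into U (w \<circ> pr) x) = inv_into V w x"
proof -
  have V: "openin (top_of_set M) V" "V \<subseteq> M" "open (w ` V)" "homeomorphism V (w ` V) w (inv_into V w)"
      "inj_on w V"
    by (fact complex_atlasD[OF assms(1,3)])+
  have op: "open ((w \<circ> pr) ` X)" if "openin (top_of_set U) X" for X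
  proof -
    have "openin (top_of_set Mt) X" "X \<subseteq> U"
      using that U(1) openin_trans openin_imp_subset by blast+
    then have "openin (top_of_set M) (pr ` X)" "pr ` X \<subseteq> V"
      using covering_space_open_image[OF assms(2)] U(3) by blast+
    then have "openin (top_of_set V) (pr ` X)"
      using V(2) openin_subset_trans by blast
    then have "openin (top_of_set (w ` V)) (w ` (pr ` X))"
      by (rule homeomorphism_imp_open_map[OF V(4)])
    then show ?thesis
      using V(3) by (simp add: openin_open_eq image_comp)
  qed
  then show "open ((w \<circ> pr) ` U)"
    by simp
  have cont: "continuous_on U (w \<circ> pr)"
  proof (rule continuous_on_compose)
    show "continuous_on U pr"
      using covering_space_imp_continuous[OF assms(2)] openin_imp_subset[OF U(1)] continuous_on_subset by blast
    show "continuous_on (pr ` U) w"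
      using V(4) U(3) by (meson continuous_on_subset homeomorphism_cont1)
  qed
  show inj: "inj_on (w \<circ> pr) U"
    using U(2,3) V(5) by (meson comp_inj_on inj_on_subset)
  obtain g where g: "homeomorphism U ((w \<circ> pr) ` U) (w \<circ> pr) g"
  proof (rule homeomorphism_injective_open_map[OF cont refl inj])
    fix X assume X: "openin (top_of_set U) X"
    show "openin (top_of_set ((w \<circ> pr) ` U)) ((w \<circ> pr) ` X)"
      using op[OF X] openin_imp_subset[OF X] \<open>open ((w \<circ> pr) ` U)\<close>
      by (simp add: openin_open_eq image_mono)
  qed blast
  show "homeomorphism U ((w \<circ> pr) ` U) (w \<circ> pr) (inv_into U (w \<circ> pr))"
    by (rule homeomorphism_inv_into[OF g])
  show "pr (inv_into U (w \<circ> pr) x) = inv_into V w x" if "x \<in> (w \<circ> pr) ` U"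
  proof -
    from that obtain q where q: "q \<in> U" "x = w (pr q)"
      by auto
    then have "inv_into U (w \<circ> pr) x = q"
      using inj by (metis comp_apply inv_into_f_f)
    then show ?thesis
      using q U(3) V(5) by auto
  qed
qed

lemma lifted_atlasE:
  assumes "(U, z) \<in> lifted_atlas Mt pr A"
  obtains V w where "z = w \<circ> pr" "(V, w) \<in> A" "openin (top_of_set Mt) U" "inj_on pr U" "pr ` U \<subseteq> V"
  using assms unfolding lifted_atlas_def by auto

lemma complex_atlas_lifted:
  assumes "complex_atlas M A" "covering_space Mt pr M"
  shows "complex_atlas Mt (lifted_atlas Mt pr A)"
  unfolding complex_atlas_def
proof (intro conjI)
  have "\<exists>U\<in>fst ` lifted_atlas Mt pr A. q \<in> U" if qMt: "q \<in> Mt" for q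
  proof -
    have "pr q \<in> M"
      using that covering_space_imp_surjective[OF assms(2)] by blast
    then obtain V w where V: "(V, w) \<in> A" "pr q \<in> V"
      by (rule complex_atlas_chart[OF assms(1)])
    obtain T u g where T: "q \<in> T" "openin (top_of_set Mt) T" "pr q \<in> u" "openin (top_of_set M) u"
        "homeomorphism T u pr g"
      by (rule covering_space_local_homeomorphism[OF assms(2) qMt])
    define U where "U = T \<inter> (Mt \<inter> pr -` V)"
    have "openin (top_of_set Mt) (Mt \<inter> pr -` V)"
      using covering_space_imp_continuous[OF assms(2)] covering_space_imp_surjective[OF assms(2)]
        complex_atlasD(1)[OF assms(1) V(1)]
      by (simp add: continuous_on_open)
    then have "openin (top_of_set Mt) U"
      unfolding U_def using T(2) by blast
    moreover have "inj_on pr U"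
      by (rule inj_on_inverseI[of _ g]) (use T(5) in \<open>simp add: U_def homeomorphism_def\<close>)
    moreover have "pr ` U \<subseteq> V" "q \<in> U"
      using T(1) V(2) that by (auto simp: U_def)
    ultimately show ?thesis
      using V(1) unfolding lifted_atlas_def by force
  qed
  moreover have "U \<subseteq> Mt" if "(U, z) \<in> lifted_atlas Mt pr A" for U z
    using that by (elim lifted_atlasE) (rule openin_imp_subset)
  ultimately show "\<Union> (fst ` lifted_atlas Mt pr A) = Mt"
    by fastforce
next
  have "openin (top_of_set Mt) U \<and> open (z ` U) \<and> homeomorphism U (z ` U) z (inv_into U z)"
    if "(U, z) \<in> lifted_atlas Mt pr A" for U z
    using that by (elim lifted_atlasE) (use lifted_chart(1,2)[OF assms] in simp)
  then show "\<forall>(U, z)\<in>lifted_atlas Mt pr A. openin (top_of_set Mt) U \<and> open (z ` U) \<and>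
      homeomorphism U (z ` U) z (inv_into U z)"
    by fast
next
  have "((w2 \<circ> pr) \<circ> inv_into U1 (w1 \<circ> pr)) holomorphic_on (w1 \<circ> pr) ` (U1 \<inter> U2)"
    if 1: "(V1, w1) \<in> A" "openin (top_of_set Mt) U1" "inj_on pr U1" "pr ` U1 \<subseteq> V1"
    and 2: "(V2, w2) \<in> A" "openin (top_of_set Mt) U2" "inj_on pr U2" "pr ` U2 \<subseteq> V2" for U1 V1 w1 U2 V2 w2
  proof -
    have "(w2 \<circ> inv_into V1 w1) holomorphic_on w1 ` (V1 \<inter> V2)"
      using assms(1) 1(1) 2(1) unfolding complex_atlas_def by blast
    moreover have "(w1 \<circ> pr) ` (U1 \<inter> U2) \<subseteq> w1 ` (V1 \<inter> V2)"
      using 1(4) 2(4) by auto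
    ultimately have "(w2 \<circ> inv_into V1 w1) holomorphic_on (w1 \<circ> pr) ` (U1 \<inter> U2)"
      by (rule holomorphic_on_subset)
    then show ?thesis
      by (rule holomorphic_transform) (use lifted_chart(4)[OF assms 1] in auto)
  qed
  then have "(w \<circ> inv_into U z) holomorphic_on z ` (U \<inter> V)"
    if "(U, z) \<in> lifted_atlas Mt pr A" "(V, w) \<in> lifted_atlas Mt pr A" for U z V w
    using that by (elim lifted_atlasE) simp
  then show "\<forall>(U, z)\<in>lifted_atlas Mt pr A. \<forall>(V, w)\<in>lifted_atlas Mt pr A.
      (w \<circ> inv_into U z) holomorphic_on z ` (U \<inter> V)"
    by fast
qed

text \<open>In a lifted chart the coordinate expression of \<open>G \<circ> pr\<close> coincides on
  an open set with that of \<open>G\<close>, so values, limits and poles agree.\<close>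

lemma meromorphic_fun_lifted:
  assumes "complex_atlas M A" "covering_space Mt pr M" "meromorphic_fun A G"
  shows "meromorphic_fun (lifted_atlas Mt pr A) (G \<circ> pr)"
proof -
  have "local_expr (G \<circ> pr) U (w \<circ> pr) nicely_meromorphic_on (w \<circ> pr) ` U \<and>
      (\<forall>p\<in>U. (G \<circ> pr) p = None \<longleftrightarrow> is_pole (local_expr (G \<circ> pr) U (w \<circ> pr)) ((w \<circ> pr) p))"
    if V: "(V, w) \<in> A" and U: "openin (top_of_set Mt) U" "inj_on pr U" "pr ` U \<subseteq> V" for U V w
  proof -
    note ch = lifted_chart[OF assms(1,2) V U]
    let ?f = "local_expr (G \<circ> pr) U (w \<circ> pr)" and ?g = "local_expr G V w"
    have eq: "?f x = ?g x" if "x \<in> (w \<circ> pr) ` U" for x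
      using ch(4)[OF that] by (simp add: local_expr_def)
    have ev: "eventually (\<lambda>x. ?f x = ?g x) (at x)" if "x \<in> (w \<circ> pr) ` U" for x
      using eventually_at_in_open'[OF ch(1) that] eq by (auto elim: eventually_mono)
    have pole: "is_pole ?f x \<longleftrightarrow> is_pole ?g x" if "x \<in> (w \<circ> pr) ` U" for x
      by (rule is_pole_cong[OF ev[OF that] refl])
    have G: "?g nicely_meromorphic_on w ` V" "\<forall>p\<in>V. G p = None \<longleftrightarrow> is_pole ?g (w p)"
      using assms(3) V unfolding meromorphic_fun_def by fast+
    have "(w \<circ> pr) ` U \<subseteq> w ` V"
      using U(3) by auto
    then have g: "?g nicely_meromorphic_on (w \<circ> pr) ` U"
      using G(1) nicely_meromorphic_on_subset by blast
    have "?f meromorphic_on (w \<circ> pr) ` U"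
      using g meromorphic_on_cong[OF ev refl] unfolding nicely_meromorphic_on_def by blast
    moreover have "is_pole ?f x \<and> ?f x = 0 \<or> ?f \<midarrow>x\<rightarrow> ?f x" if "x \<in> (w \<circ> pr) ` U" for x
      using g that tendsto_cong[OF ev[OF that]] pole[OF that] eq[OF that]
      unfolding nicely_meromorphic_on_def by auto
    ultimately show ?thesis
      using G(2) U(3) pole unfolding nicely_meromorphic_on_def by auto
  qed
  then have "local_expr (G \<circ> pr) U z nicely_meromorphic_on z ` U \<and>
      (\<forall>p\<in>U. (G \<circ> pr) p = None \<longleftrightarrow> is_pole (local_expr (G \<circ> pr) U z) (z p))"
    if "(U, z) \<in> lifted_atlas Mt pr A" for U z
    using that by (elim lifted_atlasE) simp
  then show ?thesis
    unfolding meromorphic_fun_def by fast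
qed

subsection \<open>The positive light cone and the sphere\<close>

lemma cmat_simps [simp]:
  "cmat a b c d $ 1 $ 1 = a" "cmat a b c d $ 1 $ 2 = b"
  "cmat a b c d $ 2 $ 1 = c" "cmat a b c d $ 2 $ 2 = d"
  by (simp_all add: cmat_def)

lemma scaleR_matrix_component: "(k *\<^sub>R X) $ i $ j = of_real k * (X $ i $ j)" for X :: "complex^2^2"
  by (simp flip: scaleR_conv_of_real)

lemma cmat_eq_iff:
  "X = cmat a b c d \<longleftrightarrow> X $ 1 $ 1 = a \<and> X $ 1 $ 2 = b \<and> X $ 2 $ 1 = c \<and> X $ 2 $ 2 = d"
  by (auto simp: vec_eq_iff forall_2)

text \<open>The column \<open>(u, v)\<close> times its adjoint, spelled out so that it is literally
  the matrix in \<open>sphere_point\<close>.\<close>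

abbreviation outer :: "complex \<Rightarrow> complex \<Rightarrow> complex^2^2" where
  "outer u v \<equiv> cmat (u * cnj u) (u * cnj v) (v * cnj u) (v * cnj v)"

lemma sphere_quot_outer: "sphere_quot u v = sphere_quot (u * cnj v) (v * cnj v)"
  by (simp add: sphere_quot_def)

text \<open>Uniqueness holds because two vectors with outer products on the same ray have
  proportional outer products, and \<open>u / v\<close> is the quotient of the second-column
  entries, in which the factor cancels.\<close>

lemma sphere_point_light_ray:
  assumes "(u, v) \<noteq> (0, 0)" "k > 0" "X = k *\<^sub>R outer u v"
  shows "sphere_point (light_ray X) = sphere_quot u v"
  unfolding sphere_point_def
proof (rule the_equality)
  have "outer u v = inverse k *\<^sub>R X"
    using assms by simp
  then have "outer u v \<in> light_ray X"
    unfolding light_ray_def using \<open>k > 0\<close> positive_imp_inverse_positive by blast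
  then show "\<exists>u' v'. (u', v') \<noteq> (0, 0) \<and> outer u' v' \<in> light_ray X \<and> sphere_quot u v = sphere_quot u' v'"
    using assms(1) by blast
next
  fix c
  assume "\<exists>u' v'. (u', v') \<noteq> (0, 0) \<and> outer u' v' \<in> light_ray X \<and> c = sphere_quot u' v'"
  then obtain u' v' r where r: "r > 0" "outer u' v' = r *\<^sub>R X" and c: "c = sphere_quot u' v'"
    by (auto simp: light_ray_def)
  define t where "t = of_real r * complex_of_real k"
  have "t \<noteq> 0"
    using r assms(2) by (simp add: t_def)
  have "outer u' v' = (r * k) *\<^sub>R outer u v"
    using r assms(3) by simp
  then have "u' * cnj v' = t * (u * cnj v)" "v' * cnj v' = t * (v * cnj v)"
    by (simp_all add: vec_eq_iff forall_2 t_def scaleR_matrix_component del: vector_scaleR_component)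
  then show "c = sphere_quot u v"
    unfolding c using \<open>t \<noteq> 0\<close> by (subst (1 2) sphere_quot_outer) (simp add: sphere_quot_def)
qed

section \<open>The rank-one form of \<open>f - \<nu>\<close> at regular points\<close>

text \<open>The arguments of \<open>outer\<close> are the components of \<open>P\<close> applied to
  \<open>(- \<epsilon> * cnj h, s)\<close>, the negative of the vector \<open>w\<close> of the
  overview; the sign cancels in the outer product.\<close>

lemma rep_diff:
  fixes g g1 g2 h :: complex and e :: real
  assumes "1 + e * (cmod h)\<^sup>2 > 0" "g1 \<noteq> 0"
  defines "s \<equiv> complex_of_real (1 + e * (cmod h)\<^sup>2)"
  defines "c \<equiv> \<i> * g1 powr (- 3 / 2)"
  defines "P \<equiv> rep_G g g1 g2"
  shows "P ** rep_A e h ** adj P - P ** rep_B e h ** adj P =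
    (2 / (1 + e * (cmod h)\<^sup>2)) *\<^sub>R
      outer (c * (g * (of_real e * cnj h * g1 + g2 / 2 * s) - g1\<^sup>2 * s))
            (c * (of_real e * cnj h * g1 + g2 / 2 * s))"
proof -
  have s: "s \<noteq> 0" "cnj s = s"
    using assms(1) by (simp_all add: s_def del: of_real_add of_real_mult)
  define w where "w = vector [of_real e * cnj h, - s]"
  have hh: "of_real ((cmod h)\<^sup>2) = h * cnj h"
    by (simp only: complex_norm_square)
  have "rep_A e h - rep_B e h = 
      cmat (2 * (of_real e)\<^sup>2 * (h * cnj h) / s) (- 2 * of_real e * cnj h) (- 2 * of_real e * h) (2 * s)"
    using s
    by (simp add: cmat_eq_iff rep_A_def rep_B_def s_def[symmetric] field_simps flip: hh)
       (simp add: s_def field_simps)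
  moreover have "P ** rep_A e h ** adj P - P ** rep_B e h ** adj P = P ** (rep_A e h - rep_B e h) ** adj P"
    by (simp add: vec_eq_iff matrix_matrix_mult_def sum_2 algebra_simps)
  ultimately have 1: "P ** rep_A e h ** adj P - P ** rep_B e h ** adj P = P ** 
      cmat (2 * (of_real e)\<^sup>2 * (h * cnj h) / s) (- 2 * of_real e * cnj h) (- 2 * of_real e * h) (2 * s) ** adj P"
    by simp
  have P: "P = cmat (c * (- g * g1)) (c * (g * g2 / 2 - g1\<^sup>2)) (c * (- g1)) (c * (g2 / 2))"
    by (simp add: P_def rep_G_def c_def Let_def)
  have k: "complex_of_real (2 / (1 + e * (cmod h)\<^sup>2)) = 2 / s"
    by (simp add: s_def)
  show ?thesis
    unfolding 1 using s
    by (simp add: vec_eq_iff forall_2 P adj_def map_matrix_def transpose_def matrix_matrix_mult_def sum_2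
        scaleR_matrix_component k del: of_real_divide vector_scaleR_component)
       (simp add: field_simps power2_eq_square)
qed

section \<open>The rank-one form of \<open>f - \<nu>\<close> from the geometry of the pair\<close>

lemma hermitian_cmat:
  assumes "adj X = X"
  obtains a b1 b2 d where "X = cmat (of_real a) (Complex b1 b2) (cnj (Complex b1 b2)) (of_real d)"
proof -
  have "cnj (X $ 1 $ 1) = X $ 1 $ 1" "cnj (X $ 2 $ 2) = X $ 2 $ 2" "cnj (X $ 1 $ 2) = X $ 2 $ 1"
    using arg_cong[OF assms, of "\<lambda>Y :: complex^2^2. Y $ 1 $ 1"] arg_cong[OF assms, of "\<lambda>Y :: complex^2^2. Y $ 2 $ 2"]
      arg_cong[OF assms, of "\<lambda>Y :: complex^2^2. Y $ 2 $ 1"]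
    by (simp_all add: adj_def map_matrix_def transpose_def)
  then have "X = cmat (of_real (Re (X $ 1 $ 1))) (Complex (Re (X $ 1 $ 2)) (Im (X $ 1 $ 2)))
      (cnj (Complex (Re (X $ 1 $ 2)) (Im (X $ 1 $ 2)))) (of_real (Re (X $ 2 $ 2)))"
    by (simp add: vec_eq_iff forall_2 cmat_def complex_eq_iff)
  then show ?thesis
    by (rule that)
qed

text \<open>Reverse Cauchy--Schwarz: the Hermitian matrix with entries \<open>a, b, d\<close> is a positive timelike
  vector, the one with entries \<open>x, y, t\<close> is lightlike.\<close>

lemma lightlike_positive:
  fixes a b1 b2 d x y1 y2 t :: real
  assumes "a * d - (b1\<^sup>2 + b2\<^sup>2) > 0" "a > 0" "d > 0" "x * t = y1\<^sup>2 + y2\<^sup>2"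
    and neg: "a * t + d * x - 2 * (b1 * y1 + b2 * y2) > 0"
  shows "x \<ge> 0" "t \<ge> 0" "x > 0 \<or> t > 0"
proof -
  have xt: "x * t \<ge> 0"
    using assms(4) by simp
  have pos: "x + t > 0"
  proof (rule ccontr)
    assume "\<not> x + t > 0"
    with xt have xt': "x \<le> 0" "t \<le> 0"
      by (smt (verit) mult_neg_pos mult_pos_neg)+
    \<comment> \<open>By Lagrange's identity the difference of the two sides is
      \<open>(b1 * y2 - b2 * y1)\<^sup>2\<close>.\<close>
    have "(b1 * y1 + b2 * y2)\<^sup>2 \<le> (b1\<^sup>2 + b2\<^sup>2) * (y1\<^sup>2 + y2\<^sup>2)"
      using zero_le_power2[of "b1 * y2 - b2 * y1"] by (simp add: power2_eq_square algebra_simps)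
    also have "\<dots> \<le> (a * d) * (x * t)"
      using assms(1-4) by (intro mult_mono) auto
    \<comment> \<open>The inequality of arithmetic and geometric means for \<open>a * t\<close> and
      \<open>d * x\<close>.\<close>
    also have "\<dots> \<le> ((a * t + d * x) / 2)\<^sup>2"
      using zero_le_power2[of "a * t - d * x"] by (simp add: power2_eq_square field_simps)
    finally have "\<bar>b1 * y1 + b2 * y2\<bar> \<le> \<bar>(a * t + d * x) / 2\<bar>"
      by (simp only: abs_le_square_iff)
    moreover have "a * t \<le> 0" "d * x \<le> 0"
      using xt' assms(2,3) by (simp_all add: mult_nonneg_nonpos)
    moreover have False if "\<bar>p\<bar> \<le> \<bar>s / 2\<bar>" "s \<le> 0" "s - 2 * p > 0" for p s :: real
      using that by linarith
    ultimately show False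
      using neg by (metis add_nonpos_nonpos)
  qed
  then show "x > 0 \<or> t > 0"
    by linarith
  show "x \<ge> 0" "t \<ge> 0"
    using pos xt by (smt (verit) mult_neg_pos mult_pos_neg)+
qed

text \<open>A nonzero positive null Hermitian matrix has rank one and is a square in the sense of
  \<open>outer\<close>. As only the pointwise relations between \<open>f\<close> and
  \<open>\<nu>\<close> enter, this covers the points where the representation formula breaks
  down.\<close>

lemma front_diff_eq_outer:
  assumes f: "f \<in> hyperbolic3" and \<nu>: "\<nu> \<in> de_sitter3" and ort: "lorentz f \<nu> = 0"
  shows "\<exists>u v. (u, v) \<noteq> (0, 0) \<and> f - \<nu> = outer u v"
proof -
  obtain a b1 b2 d where F: "f = cmat (of_real a) (Complex b1 b2) (cnj (Complex b1 b2)) (of_real d)"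
    using f hermitian_cmat unfolding hyperbolic3_def by blast
  obtain p q1 q2 r where N: "\<nu> = cmat (of_real p) (Complex q1 q2) (cnj (Complex q1 q2)) (of_real r)"
    using \<nu> hermitian_cmat unfolding de_sitter3_def by blast
  have "det f = 1" "det \<nu> = -1" "Re (trace f) > 0"
    using f \<nu> unfolding hyperbolic3_def de_sitter3_def by auto
  then have detf: "a * d - (b1\<^sup>2 + b2\<^sup>2) = 1" and detn: "p * r - (q1\<^sup>2 + q2\<^sup>2) = -1" and tr: "a + d > 0"
    by (simp_all add: F N det_2 trace_def sum_2 complex_eq_iff power2_eq_square)
  have orth: "a * r + d * p = 2 * (b1 * q1 + b2 * q2)"
    using ort by (simp add: F N lorentz_def det_2 power2_eq_square algebra_simps)
  have "a * d > 0"
    using detf by (smt (verit) zero_le_power2)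
  then have ad: "a > 0" "d > 0"
    using tr by (smt (verit) mult_nonneg_nonpos mult_nonpos_nonneg)+
  define x t y1 y2 where "x = a - p" and "t = d - r" and "y1 = b1 - q1" and "y2 = b2 - q2"
  note defs = x_def t_def y1_def y2_def
  have X: "f - \<nu> = cmat (of_real x) (Complex y1 y2) (cnj (Complex y1 y2)) (of_real t)"
    by (simp add: F N defs vec_eq_iff forall_2 complex_eq_iff)
  have null: "x * t = y1\<^sup>2 + y2\<^sup>2"
    using detf detn orth by (simp add: defs power2_eq_square algebra_simps)
  \<comment> \<open>The left-hand side is \<open>- 2 * lorentz f (f - \<nu>)\<close>, and
    \<open>lorentz f f = - 1\<close>.\<close>
  have "a * t + d * x - 2 * (b1 * y1 + b2 * y2) = 2"
    using detf orth by (simp add: defs power2_eq_square algebra_simps)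
  then have "a * t + d * x - 2 * (b1 * y1 + b2 * y2) > 0" "a * d - (b1\<^sup>2 + b2\<^sup>2) > 0"
    using detf by linarith+
  note pos = lightlike_positive[OF this(2) ad null this(1)]
  show ?thesis
  \<comment> \<open>\<open>t\<close> has to be the squared modulus of \<open>v\<close>. If it
    vanishes, nullity kills the off-diagonal entries and the point is infinity; otherwise the free
    phase allows a real \<open>v\<close>, and the off-diagonal entry then determines
    \<open>u\<close>.\<close>
  proof (cases "t = 0")
    case True
    then have "y1 = 0" "y2 = 0" "x > 0"
      using null pos by (auto simp: sum_power2_eq_zero_iff)
    then have "f - \<nu> = outer (of_real (sqrt x)) 0"
      unfolding X using True by (simp add: vec_eq_iff forall_2 complex_eq_iff)
    then show ?thesis
      using \<open>x > 0\<close> by (intro exI[of _ "of_real (sqrt x)"] exI[of _ 0]) simp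
  next
    case False
    then have t: "t > 0"
      using pos by simp
    define v where "v = complex_of_real (sqrt t)"
    define u where "u = Complex y1 y2 / v"
    have v: "v * cnj v = of_real t" "v \<noteq> 0" "cnj v = v"
      using t by (simp_all add: v_def flip: of_real_mult)
    have "Complex y1 y2 * cnj (Complex y1 y2) = of_real (x * t)"
      unfolding null by (simp add: complex_eq_iff power2_eq_square)
    then have "u * cnj u * (v * cnj v) = of_real x * of_real t"
      using v by (simp add: u_def)
    then have "u * cnj u = of_real x"
      unfolding v(1) using t by simp
    moreover have "u * cnj v = Complex y1 y2" "v * cnj u = cnj (Complex y1 y2)"
      using v(2) unfolding v(3) by (simp_all add: u_def v(3))
    ultimately have "f - \<nu> = outer u v"
      unfolding X v(1) by simp
    then show ?thesis
      using v(2) by (intro exI[of _ u] exI[of _ v]) simp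
  qed
qed

section \<open>Limits on the Riemann sphere\<close>

text \<open>The choice of \<open>u\<close> and \<open>v\<close> need not vary continuously, but the
  matrix entries do. The second column gives the quotient away from infinity, the first column away
  from 0, and these two regions cover the sphere.\<close>

lemma sphere_quot_outer_entries:
  fixes X :: "complex^2^2"
  assumes "X = outer u v" "(u, v) \<noteq> (0, 0)"
  shows "X $ 2 $ 2 \<noteq> 0 \<Longrightarrow> sphere_quot u v = sphere_quot (X $ 1 $ 2) (X $ 2 $ 2)"
    "X $ 1 $ 1 \<noteq> 0 \<Longrightarrow> sphere_quot u v = sphere_quot (X $ 1 $ 1) (X $ 2 $ 1)"
    "X $ 1 $ 1 \<noteq> 0 \<or> X $ 2 $ 2 \<noteq> 0"
  using assms by (auto simp: sphere_quot_def)

lemma limitin_sphere_quot: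
  assumes "(a \<longlongrightarrow> a0) F" "(c \<longlongrightarrow> c0) F" "(a0, c0) \<noteq> (0, 0)"
  shows "limitin riemann_sphere (\<lambda>x. sphere_quot (a x) (c x)) (sphere_quot a0 c0) F"
  unfolding limitin_def
proof (intro conjI allI impI)
  show "sphere_quot a0 c0 \<in> topspace riemann_sphere"
    by (cases "sphere_quot a0 c0") (auto simp: riemann_sphere_def)
next
  fix W assume W: "openin riemann_sphere W \<and> sphere_quot a0 c0 \<in> W"
  show "eventually (\<lambda>x. sphere_quot (a x) (c x) \<in> W) F"
  proof (cases "c0 = 0")
    case True
    then have a0: "a0 \<noteq> 0" and "None \<in> W"
      using assms(3) W by (auto simp: sphere_quot_def)
    then obtain K where "compact K" and K: "W = insert None (Some ` (- K))"
      using W by (auto simp: riemann_sphere_def openin_Alexandroff_compactification Compl_eq_Diff_UNIV)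
    then obtain r where r: "\<And>y. y \<in> K \<Longrightarrow> norm y \<le> r"
      using compact_imp_bounded bounded_iff by metis
    \<comment> \<open>Leaving the compact set \<open>K\<close> is phrased without division, since
      \<open>c x\<close> may vanish along the filter.\<close>
    have "((\<lambda>x. norm (a x) - r * norm (c x)) \<longlongrightarrow> norm a0 - r * norm c0) F"
      by (intro tendsto_intros assms)
    moreover have "norm a0 - r * norm c0 > 0"
      using a0 True by simp
    ultimately have "eventually (\<lambda>x. norm (a x) - r * norm (c x) > 0) F"
      by (rule order_tendstoD)
    then show ?thesis
    proof eventually_elim
      case (elim x)
      have "a x / c x \<notin> K" if "c x \<noteq> 0"
      proof
        assume "a x / c x \<in> K"
        then have "norm (a x) / norm (c x) \<le> r"
          using r by (metis norm_divide)
        then show False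
          using elim that by (simp add: field_simps)
      qed
      then show ?case
        by (auto simp: sphere_quot_def K)
    qed
  next
    case False
    have "openin euclidean {y. Some y \<in> W}"
      using W openin_continuous_map_preimage[OF continuous_map_Some, of "euclidean :: complex topology" W]
      by (simp add: riemann_sphere_def)
    then have "open {y. Some y \<in> W}"
      by simp
    moreover have "a0 / c0 \<in> {y. Some y \<in> W}"
      using W False by (simp add: sphere_quot_def)
    moreover have "((\<lambda>x. a x / c x) \<longlongrightarrow> a0 / c0) F"
      using assms(1,2) False by (rule tendsto_divide)
    ultimately have "eventually (\<lambda>x. a x / c x \<in> {y. Some y \<in> W}) F"
      by (rule topological_tendstoD[rotated])
    moreover have "eventually (\<lambda>x. c x \<noteq> 0) F"
      using assms(2) False by (rule tendsto_imp_eventually_ne)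
    ultimately show ?thesis
      by eventually_elim (simp add: sphere_quot_def)
  qed
qed

lemma limitin_eventually_eq:
  assumes "limitin Y g l F" "eventually (\<lambda>x. f x = g x) F"
  shows "limitin Y f l F"
  using assms unfolding limitin_def by (auto elim: eventually_elim2)

text \<open>A diagonal entry that is nonzero for \<open>X0\<close> stays nonzero along the filter,
  so one and the same quotient of entries describes both the nearby points and the limit.\<close>

lemma limitin_sphere_point:
  fixes X :: "'a \<Rightarrow> complex^2^2"
  assumes lim: "(X \<longlongrightarrow> X0) F"
    and X: "eventually (\<lambda>x. \<exists>u v. (u, v) \<noteq> (0, 0) \<and> X x = outer u v) F"
    and X0: "(u0, v0) \<noteq> (0, 0)" "X0 = outer u0 v0"
  shows "limitin riemann_sphere (\<lambda>x. sphere_point (light_ray (X x))) (sphere_point (light_ray X0)) F"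
proof -
  have pt: "sphere_point (light_ray Y) = sphere_quot u v" if "(u, v) \<noteq> (0, 0)" "Y = outer u v" for Y u v
    using sphere_point_light_ray[of u v 1 Y] that by simp
  have entries: "((\<lambda>x. X x $ i $ j) \<longlongrightarrow> X0 $ i $ j) F" for i j
    by (intro tendsto_vec_nth lim)
  consider "X0 $ 2 $ 2 \<noteq> 0" | "X0 $ 1 $ 1 \<noteq> 0"
    using sphere_quot_outer_entries(3)[OF X0(2,1)] by blast
  then show ?thesis
  proof cases
    case 1
    have "eventually (\<lambda>x. X x $ 2 $ 2 \<noteq> 0) F"
      using entries 1 by (rule tendsto_imp_eventually_ne)
    with X have "eventually (\<lambda>x. sphere_point (light_ray (X x)) = sphere_quot (X x $ 1 $ 2) (X x $ 2 $ 2)) F"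
      by eventually_elim (metis pt sphere_quot_outer_entries(1))
    moreover have "sphere_point (light_ray X0) = sphere_quot (X0 $ 1 $ 2) (X0 $ 2 $ 2)"
      using pt[OF X0] sphere_quot_outer_entries(1)[OF X0(2,1) 1] by simp
    ultimately show ?thesis
      using limitin_sphere_quot[OF entries entries, of 1 2 2 2] 1 limitin_eventually_eq by simp
  next
    case 2
    have "eventually (\<lambda>x. X x $ 1 $ 1 \<noteq> 0) F"
      using entries 2 by (rule tendsto_imp_eventually_ne)
    with X have "eventually (\<lambda>x. sphere_point (light_ray (X x)) = sphere_quot (X x $ 1 $ 1) (X x $ 2 $ 1)) F"
      by eventually_elim (metis pt sphere_quot_outer_entries(2))
    moreover have "sphere_point (light_ray X0) = sphere_quot (X0 $ 1 $ 1) (X0 $ 2 $ 1)"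
      using pt[OF X0] sphere_quot_outer_entries(2)[OF X0(2,1) 2] by simp
    ultimately show ?thesis
      using limitin_sphere_quot[OF entries entries, of 1 1 2 1] 2 limitin_eventually_eq by simp
  qed
qed

text \<open>Chart domains are relatively open, so the limit at \<open>p\<close> within
  \<open>U\<close> is the limit within \<open>S\<close>.\<close>

lemma continuous_on_chartwise:
  assumes "complex_atlas S B" "\<And>U z. (U, z) \<in> B \<Longrightarrow> continuous_on (z ` U) (f \<circ> inv_into U z)"
  shows "continuous_on S f"
  unfolding continuous_on_eq_continuous_within
proof
  fix p assume "p \<in> S"
  then obtain U z where Uz: "(U, z) \<in> B" "p \<in> U"
    by (rule complex_atlas_chart[OF assms(1)])
  note U = complex_atlasD[OF assms(1) Uz(1)]
  have "continuous_on U ((f \<circ> inv_into U z) \<circ> z)"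
    by (rule continuous_on_compose[OF homeomorphism_cont1[OF U(4)] assms(2)[OF Uz(1)]])
  then have "continuous_on U f"
    by (rule continuous_on_eq) (use U(5) in simp)
  then have "continuous (at p within U) f"
    using Uz(2) continuous_on_eq_continuous_within by blast
  moreover obtain T where T: "open T" "U = S \<inter> T"
    using U(1) by (auto simp: openin_open)
  have "at p within U = at p within S"
    by (rule at_within_nhd[of _ T]) (use T Uz(2) in auto)
  ultimately show "continuous (at p within S) f"
    by simp
qed

lemma front_continuous_on:
  assumes "complex_atlas M A" "front M A f \<nu>"
  shows "continuous_on M f" "continuous_on M \<nu>"
proof -
  have "continuous_on (z ` U) (f \<circ> inv_into U z) \<and> continuous_on (z ` U) (\<nu> \<circ> inv_into U z)"
    if "(U, z) \<in> A" for U z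
  proof -
    have "smooth_on (f \<circ> inv_into U z) (z ` U)" "smooth_on (\<nu> \<circ> inv_into U z) (z ` U)"
      using assms(2) that unfolding front_def Let_def by fast+
    then show ?thesis
      unfolding smooth_on_def by (metis C_k_on.simps(1))
  qed
  then show "continuous_on M f" "continuous_on M \<nu>"
    using continuous_on_chartwise[OF assms(1)] by blast+
qed

theorem proposition3p12:
  fixes \<epsilon> :: real
    and M :: "'m::t2_space set" and A :: "('m set \<times> ('m \<Rightarrow> complex)) set"
    and Mt :: "'t::t2_space set" and pr :: "'t \<Rightarrow> 'm"
    and G :: "'m \<Rightarrow> complex option" and h :: "'t \<Rightarrow> complex option"
    and f \<nu> :: "'m \<Rightarrow> complex^2^2"
  assumes "riemann_surface M A"
    and "universal_covering Mt pr M"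
    and "representation_data \<epsilon> M A Mt pr G h"
    and "(f, \<nu>) \<in> W_fronts \<epsilon> M A"
    and "given_by_data \<epsilon> A Mt pr G h f \<nu>"
  defines "Gh \<equiv> mero_deriv (lifted_atlas Mt pr A) (G \<circ> pr) h"
  defines "Ghh \<equiv> mero_deriv (lifted_atlas Mt pr A) Gh h"
  defines "R \<equiv> regular_points Mt (G \<circ> pr) Gh Ghh h"
  defines "Formula \<equiv> (\<lambda>q. opposite_gauss_formula \<epsilon> (the (G (pr q))) (the (Gh q)) (the (Ghh q)) (the (h q)))"
  shows "(\<forall>q\<in>R. opposite_gauss_map f \<nu> (pr q) = Formula q) \<and>
         (\<forall>q\<in>Mt - R. q islimpt R \<and>
            limitin riemann_sphere Formula (opposite_gauss_map f \<nu> (pr q)) (at q within R))"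
proof -
  let ?B = "lifted_atlas Mt pr A"
  have A: "complex_atlas M A"
    using assms(1) by (simp add: riemann_surface_def)
  have cov: "covering_space Mt pr M" and conn: "connected Mt"
    using assms(2) simply_connected_imp_path_connected_space path_connected_imp_connected
    by (auto simp: universal_covering_def)
  have B: "complex_atlas Mt ?B"
    by (rule complex_atlas_lifted[OF A cov])
  have G: "meromorphic_fun A G" "\<not> G constant_on M" and h: "meromorphic_fun ?B h" "\<not> h constant_on Mt"
    and neg: "\<epsilon> < 0 \<Longrightarrow> q \<in> Mt \<Longrightarrow> \<exists>c. h q = Some c \<and> 1 + \<epsilon> * (cmod c)\<^sup>2 > 0" for q
    using assms(3) unfolding representation_data_def by fast+
  have Gpr: "meromorphic_fun ?B (G \<circ> pr)"
    by (rule meromorphic_fun_lifted[OF A cov G(1)])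
  have prM: "pr ` Mt = M"
    by (rule covering_space_imp_surjective[OF cov])
  have Gpr': "\<not> (G \<circ> pr) constant_on Mt"
    using G(2) unfolding constant_on_def prM[symmetric] by auto
  have front: "front M A f \<nu>"
    using assms(4) by (simp add: W_fronts_def)
  have "R \<subseteq> Mt"
    by (auto simp: R_def regular_points_def)
  have formula: "opposite_gauss_map f \<nu> (pr q) = Formula q" if q: "q \<in> R" for q
  proof -
    obtain g g1 g2 k where vals: "G (pr q) = Some g" "Gh q = Some g1" "Ghh q = Some g2" "h q = Some k" "g1 \<noteq> 0"
      using q unfolding R_def regular_points_def by auto
    define s where "s = 1 + \<epsilon> * (cmod k)\<^sup>2"
    have s: "s > 0"
    proof (cases "\<epsilon> < 0")
      case True
      then show ?thesis
        using neg[of q] vals q \<open>R \<subseteq> Mt\<close> by (auto simp: s_def)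
    next
      case False
      then show ?thesis
        by (simp add: s_def add_pos_nonneg)
    qed
    define c where "c = \<i> * g1 powr (- 3 / 2)"
    define D where "D = of_real \<epsilon> * cnj k * g1 + g2 / 2 * of_real s"
    define u where "u = c * (g * D - g1\<^sup>2 * of_real s)"
    define v where "v = c * D"
    have "f (pr q) = rep_G g g1 g2 ** rep_A \<epsilon> k ** adj (rep_G g g1 g2)"
      "\<nu> (pr q) = rep_G g g1 g2 ** rep_B \<epsilon> k ** adj (rep_G g g1 g2)"
      using assms(5) q vals unfolding given_by_data_def Let_def R_def Ghh_def Gh_def by auto
    then have X: "f (pr q) - \<nu> (pr q) = (2 / s) *\<^sub>R outer u v"
      using rep_diff[of \<epsilon> k g1 g g2] s vals(5) unfolding s_def u_def v_def c_def D_def by simp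
    have c: "c \<noteq> 0"
      using vals(5) by (simp add: c_def)
    \<comment> \<open>If \<open>v = 0\<close> then \<open>D = 0\<close>, and \<open>u\<close>
      reduces to \<open>- c * g1\<^sup>2 * s\<close>, a product of nonzero factors.\<close>
    have "(u, v) \<noteq> (0, 0)"
      using c s vals(5) by (auto simp: u_def v_def)
    then have "opposite_gauss_map f \<nu> (pr q) = sphere_quot u v"
      unfolding opposite_gauss_map_def using sphere_point_light_ray[OF _ _ X] s by simp
    also have "\<dots> = map_option (\<lambda>t. g - t) (sphere_quot (g1\<^sup>2 * of_real s) D)"
      using c by (simp add: sphere_quot_def u_def v_def diff_divide_distrib)
    also have "\<dots> = Formula q"
      by (simp add: Formula_def opposite_gauss_formula_def vals D_def s_def)
    finally show ?thesis .
  qed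
  have limit: "q islimpt R \<and> limitin riemann_sphere Formula (opposite_gauss_map f \<nu> (pr q)) (at q within R)"
    if q: "q \<in> Mt" for q
  proof
    show "q islimpt R"
      unfolding R_def Ghh_def Gh_def by (rule islimpt_regular_points[OF B conn Gpr Gpr' h q])
    let ?X = "\<lambda>q. f (pr q) - \<nu> (pr q)"
    have "continuous_on Mt ?X"
      using front_continuous_on[OF A front] covering_space_imp_continuous[OF cov] prM
      by (intro continuous_intros) (auto intro: continuous_on_compose2)
    then have "(?X \<longlongrightarrow> ?X q) (at q within R)"
      using q \<open>R \<subseteq> Mt\<close> unfolding continuous_on_def by (blast intro: tendsto_within_subset)
    moreover have outer: "\<exists>u v. (u, v) \<noteq> (0, 0) \<and> ?X r = outer u v" if "r \<in> Mt" for r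
    proof -
      have "pr r \<in> M"
        using that prM by blast
      then show ?thesis
        using front by (intro front_diff_eq_outer) (auto simp: front_def)
    qed
    moreover have inR: "eventually (\<lambda>r. r \<in> R) (at q within R)"
      by (simp add: eventually_at_filter)
    then have "eventually (\<lambda>r. \<exists>u v. (u, v) \<noteq> (0, 0) \<and> ?X r = outer u v) (at q within R)"
      by eventually_elim (use outer \<open>R \<subseteq> Mt\<close> in blast)
    ultimately have "limitin riemann_sphere (\<lambda>r. opposite_gauss_map f \<nu> (pr r))
        (opposite_gauss_map f \<nu> (pr q)) (at q within R)"
      unfolding opposite_gauss_map_def using limitin_sphere_point outer[OF q] by blast
    \<comment> \<open>The limit is restricted to \<open>R\<close> because elsewhere
      \<open>Formula\<close> may involve \<open>the None\<close>.\<close>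
    moreover have "eventually (\<lambda>r. Formula r = opposite_gauss_map f \<nu> (pr r)) (at q within R)"
      using inR by eventually_elim (simp add: formula)
    ultimately show "limitin riemann_sphere Formula (opposite_gauss_map f \<nu> (pr q)) (at q within R)"
      by (rule limitin_eventually_eq)
  qed
  show ?thesis
    using formula limit by blast
qed

end
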